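(* There exists a bounded complete dcpo $P$ such that the set $\operatorname{Max}(P)$ of maximal elements of $P$, equipped with the subspace topology inherited from the Scott topology on $P$, is homeomorphic to $\mathbb R_{\mathrm{cc}}$, the set $\mathbb R$ of real numbers with the cocountable topology.
   Context: Countable means of cardinality at most $\aleph_0$ (finite sets included). The cocountable topology on $\mathbb R$ is $\tau_{\mathrm{cc}}=\{\varnothing\}\cup\{U\subseteq\mathbb R:\mathbb R\setminus U\text{ is countable}\}$. A nonempty subset $D$ of a poset $P$ is directed if any two elements of $D$ have an upper bound in $D$. A poset is a dcpo if every directed subset has a supremum. A poset is bounded complete if every nonempty subset having an upper bound has a supremum. The Scott topology on a poset $P$ consists of the upper sets $U\subseteq P$ such that whenever $D\subseteq P$ is directed, has a supremum, and $\bigvee D\in U$, then $D\cap U\neq\varnothing$. *)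

theory Defs
  imports "HOL-Analysis.Analysis" "HOL-Algebra.Order"
begin

definition directed :: "('a, 'b) gorder_scheme \<Rightarrow> 'a set \<Rightarrow> bool" where
  "directed P D \<longleftrightarrow> D \<subseteq> carrier P \<and> D \<noteq> {} \<and>
     (\<forall>x\<in>D. \<forall>y\<in>D. \<exists>z\<in>D. x \<sqsubseteq>\<^bsub>P\<^esub> z \<and> y \<sqsubseteq>\<^bsub>P\<^esub> z)"

locale dcpo = partial_order P for P (structure) +
  assumes directed_has_lub: "directed P D \<Longrightarrow> \<exists>s. is_lub P s D"

locale bounded_complete_poset = partial_order P for P (structure) +
  assumes bounded_has_lub:
    "\<lbrakk>A \<subseteq> carrier P; A \<noteq> {}; u \<in> carrier P; \<And>x. x \<in> A \<Longrightarrow> x \<sqsubseteq> u\<rbrakk> \<Longrightarrow> \<exists>s. is_lub P s A"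

locale bounded_complete_dcpo = dcpo P + bounded_complete_poset P for P (structure)

definition Max_elements :: "('a, 'b) gorder_scheme \<Rightarrow> 'a set" where
  "Max_elements P = {m \<in> carrier P. \<forall>x\<in>carrier P. m \<sqsubseteq>\<^bsub>P\<^esub> x \<longrightarrow> x = m}"

definition scott_open :: "('a, 'b) gorder_scheme \<Rightarrow> 'a set \<Rightarrow> bool" where
  "scott_open P U \<longleftrightarrow> U \<subseteq> carrier P \<and>
     (\<forall>x\<in>U. \<forall>y\<in>carrier P. x \<sqsubseteq>\<^bsub>P\<^esub> y \<longrightarrow> y \<in> U) \<and>
     (\<forall>D s. directed P D \<and> is_lub P s D \<and> s \<in> U \<longrightarrow> D \<inter> U \<noteq> {})"

definition scott_topology :: "('a, 'b) gorder_scheme \<Rightarrow> 'a topology" where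
  "scott_topology P = topology (scott_open P)"

lemma istopology_scott_open: "istopology (scott_open P)"
  unfolding istopology_def
proof (intro conjI allI impI)
  fix S T assume S: "scott_open P S" and T: "scott_open P T"
  show "scott_open P (S \<inter> T)"
    unfolding scott_open_def
  proof (intro conjI allI impI)
    show "S \<inter> T \<subseteq> carrier P"
      using S unfolding scott_open_def by blast
    show "\<forall>x\<in>S \<inter> T. \<forall>y\<in>carrier P. x \<sqsubseteq>\<^bsub>P\<^esub> y \<longrightarrow> y \<in> S \<inter> T"
      using S T unfolding scott_open_def by blast
    fix D s assume A: "directed P D \<and> is_lub P s D \<and> s \<in> S \<inter> T"
    obtain d where d: "d \<in> D" "d \<in> S" using A S unfolding scott_open_def by blast
    obtain e where e: "e \<in> D" "e \<in> T" using A T unfolding scott_open_def by blast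
    obtain z where z: "z \<in> D" "d \<sqsubseteq>\<^bsub>P\<^esub> z" "e \<sqsubseteq>\<^bsub>P\<^esub> z"
      using A d e unfolding directed_def by blast
    have zP: "z \<in> carrier P" using A z(1) unfolding directed_def by blast
    have "z \<in> S" using S d(2) z(2) zP unfolding scott_open_def by blast
    moreover have "z \<in> T" using T e(2) z(3) zP unfolding scott_open_def by blast
    ultimately show "D \<inter> (S \<inter> T) \<noteq> {}" using z(1) by blast
  qed
next
  fix K assume K: "\<forall>S\<in>K. scott_open P S"
  show "scott_open P (\<Union>K)"
    unfolding scott_open_def
  proof (intro conjI allI impI)
    show "\<Union>K \<subseteq> carrier P" using K unfolding scott_open_def by blast
    show "\<forall>x\<in>\<Union>K. \<forall>y\<in>carrier P. x \<sqsubseteq>\<^bsub>P\<^esub> y \<longrightarrow> y \<in> \<Union>K"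
      using K unfolding scott_open_def by blast
    fix D s assume A: "directed P D \<and> is_lub P s D \<and> s \<in> \<Union>K"
    then obtain S where "S \<in> K" "s \<in> S" by blast
    then have "scott_open P S" using K by blast
    then have "D \<inter> S \<noteq> {}" using A \<open>s \<in> S\<close> unfolding scott_open_def by blast
    then obtain d where "d \<in> D" "d \<in> S" by blast
    then have "d \<in> D \<inter> \<Union>K" using \<open>S \<in> K\<close> by (intro IntI UnionI)
    then show "D \<inter> \<Union>K \<noteq> {}" by (metis empty_iff)
  qed
qed

lemma openin_scott_topology [simp]: "openin (scott_topology P) = scott_open P"
  unfolding scott_topology_def by (rule topology_inverse'[OF istopology_scott_open])

lemma topspace_scott_topology [simp]: "topspace (scott_topology P) = carrier P"
proof
  show "topspace (scott_topology P) \<subseteq> carrier P"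
    unfolding topspace_def openin_scott_topology scott_open_def by blast
  have "scott_open P (carrier P)"
    unfolding scott_open_def directed_def by blast
  then have "openin (scott_topology P) (carrier P)" by simp
  then show "carrier P \<subseteq> topspace (scott_topology P)" by (rule openin_subset)
qed

definition cocountable_topology :: "'a topology" where
  "cocountable_topology = topology (\<lambda>U. U = {} \<or> countable (- U))"

lemma istopology_cocountable: "istopology (\<lambda>U. U = {} \<or> countable (- U))"
  unfolding istopology_def
proof (intro conjI allI impI)
  fix S T :: "'a set"
  assume "S = {} \<or> countable (- S)" "T = {} \<or> countable (- T)"
  then show "S \<inter> T = {} \<or> countable (- (S \<inter> T))"
    by (auto simp: Compl_Int)
next
  fix K :: "'a set set"
  assume K: "\<forall>S\<in>K. S = {} \<or> countable (- S)"
  show "\<Union>K = {} \<or> countable (- \<Union>K)"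
  proof (cases "\<Union>K = {}")
    case False
    then obtain S where "S \<in> K" "S \<noteq> {}" by blast
    then have "countable (- S)" using K by blast
    moreover have "- \<Union>K \<subseteq> - S" using \<open>S \<in> K\<close> by (simp add: Union_upper)
    ultimately have "countable (- \<Union>K)" by (rule countable_subset[rotated])
    then show ?thesis by (rule disjI2)
  qed simp
qed

lemma openin_cocountable_topology [simp]:
  "openin cocountable_topology U \<longleftrightarrow> U = {} \<or> countable (- U)"
  unfolding cocountable_topology_def topology_inverse'[OF istopology_cocountable] by (rule refl)

lemma topspace_cocountable_topology [simp]: "topspace cocountable_topology = UNIV"
proof -
  have "openin (cocountable_topology :: 'a topology) UNIV" by simp
  then show ?thesis using openin_subset by blast
qed

text \<open>HOL cannot quantify existentially over types, so an existential statement about posets has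
  to name the type containing their carriers. The type below has cardinality
  beth 4 and is chosen only to leave ample room: carriers are arbitrary subsets of it.\<close>

type_synonym poset_universe = "real set set set"

end

theory Submission
  imports Defs
begin

text \<open>In a bounded complete dcpo the maximal elements above a given element form a closed subset of
  the space of maximal elements. For the cocountable topology this subset is countable or contains
  all maximal elements, so a point \<open>x\<close> outside an uncountable set \<open>A\<close> cannot be the supremum of
  elements lying below points of \<open>A\<close>; it has to be reached in many steps. Each step uses an
  infinite set \<open>s\<close> of points and produces an element, usually not maximal, that lies below one
  point only. The sets \<open>s\<close> are almost disjoint, which keeps directed sets bounded. The
  elements below \<open>x\<close> obtained in this way carry a countable ordinal as rank, and \<open>x\<close> is the
  supremum of those of unbounded rank.

  The points are triples of an element of a well-ordered copy of the reals, a countable ordinal (the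
  level) and a natural number (the class). A maximal almost disjoint family of increasing sequences
  of points, each with a limit as target, generates limit closures. The limit closure of
  a countable set has countably bounded levels, so it reaches every point with bounded
  rank only. The limit closure of an uncountable set contains almost all points of
  some vertical fibre at arbitrarily high levels, and such fibres are used to reach all points.\<close>

text \<open>The class coordinate reconciles two demands. Fibres and limit sequences must be almost
  disjoint: a limit sequence keeps one class, while a fibre has at most one point in each class. Yet
  almost all classes of a fibre have to be reached, which is why limits along increasing levels
  raise the class by one.

  Keeping all limit sequences would violate almost disjointness, since a sequence and its
  subsequences share their points. A maximal family suffices because a limit is determined by any
  infinite part of its sequence: a discarded sequence meets a kept one in an infinite set, and both
  have the same target.

  The first coordinate supplies as many points as there are reals. In any well-ordering bounded
  sequences have suprema, and every uncountable subset contains a part in which countable subsets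
  have strict upper bounds, so arguments about the first uncountable ordinal carry over.\<close>

hide_const (open) Order.top

section \<open>Well-ordered reals and the first uncountable ordinal\<close>

text \<open>If this set were countable, the least element of \<open>S\<close> outside it would have
  only countably many predecessors in \<open>S\<close> and hence belong to it. The lemma yields both
  the first uncountable ordinal and the directed parts of uncountable sets.\<close>

lemma uncountable_initial_part:
  fixes S :: "'a::wellorder set"
  assumes "uncountable S"
  shows "uncountable {z \<in> S. countable (S \<inter> {..z})}" (is "uncountable ?Z")
proof
  assume Z: "countable ?Z"
  have "\<exists>z. z \<in> S - ?Z"
  proof (rule ccontr)
    assume "\<nexists>z. z \<in> S - ?Z"
    then have "S \<subseteq> ?Z" by blast
    then show False using Z assms countable_subset by blast
  qed
  then obtain z where z: "z \<in> S - ?Z" and least: "\<And>y. y \<in> S - ?Z \<Longrightarrow> z \<le> y"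
    using LeastI_ex[of "\<lambda>z. z \<in> S - ?Z"] Least_le[of "\<lambda>z. z \<in> S - ?Z"] by blast
  have "S \<inter> {..z} \<subseteq> insert z ?Z"
    using least by fastforce
  then have "countable (S \<inter> {..z})"
    by (rule countable_subset) (use Z in simp)
  with z show False by simp
qed

definition real_wo :: "real rel" where
  "real_wo = (SOME r. well_order_on UNIV r)"

lemma real_wo: "well_order_on UNIV real_wo"
  unfolding real_wo_def using well_order_on someI_ex by metis

typedef wreal = "UNIV :: real set" ..

instantiation wreal :: wellorder
begin

definition less_eq_wreal :: "wreal \<Rightarrow> wreal \<Rightarrow> bool" where
  "less_eq_wreal x y \<longleftrightarrow> (Rep_wreal x, Rep_wreal y) \<in> real_wo"

definition less_wreal :: "wreal \<Rightarrow> wreal \<Rightarrow> bool" where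
  "less_wreal x y \<longleftrightarrow> x \<le> y \<and> x \<noteq> y"

instance
proof
  have lin: "linear_order_on UNIV real_wo"
    using real_wo unfolding well_order_on_def by auto
  have r: "refl real_wo" and t: "trans real_wo" and a: "antisym real_wo" and tot: "total real_wo"
    using lin unfolding linear_order_on_def partial_order_on_def preorder_on_def by auto
  fix x y z :: wreal
  show "x \<le> x"
    using r by (simp add: less_eq_wreal_def refl_on_def)
  show "x \<le> y \<Longrightarrow> y \<le> z \<Longrightarrow> x \<le> z"
    unfolding less_eq_wreal_def using t transD by metis
  show anti: "x \<le> y \<Longrightarrow> y \<le> x \<Longrightarrow> x = y"
    unfolding less_eq_wreal_def using antisymD[OF a] by (simp add: Rep_wreal_inject[symmetric])
  then show "x < y \<longleftrightarrow> x \<le> y \<and> \<not> y \<le> x"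
    using \<open>x \<le> x\<close> by (auto simp: less_wreal_def)
  show "x \<le> y \<or> y \<le> x"
    using tot r unfolding less_eq_wreal_def total_on_def refl_on_def by (metis UNIV_I)
next
  have wf: "wf (real_wo - Id)"
    using real_wo unfolding well_order_on_def by auto
  fix P :: "wreal \<Rightarrow> bool" and a
  assume step: "\<And>x. (\<And>y. y < x \<Longrightarrow> P y) \<Longrightarrow> P x"
  have "P (Abs_wreal u)" for u
  proof (induction u rule: wf_induct_rule[OF wf])
    case (1 u)
    show ?case
    proof (rule step)
      fix y assume "y < Abs_wreal u"
      then have "(Rep_wreal y, u) \<in> real_wo - Id"
        by (auto simp: less_wreal_def less_eq_wreal_def Abs_wreal_inverse Rep_wreal_inverse)
      then show "P y"
        using 1 Rep_wreal_inverse by metis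
    qed
  qed
  then show "P a"
    by (metis Rep_wreal_inverse)
qed

end

lemma uncountable_wreal: "uncountable (UNIV :: wreal set)"
proof
  assume "countable (UNIV :: wreal set)"
  then have "countable (range Rep_wreal)"
    by simp
  then show False
    using uncountable_UNIV_real type_definition.Rep_range[OF type_definition_wreal] by simp
qed

text \<open>Realised as an initial segment of \<open>wreal\<close>, so that its cardinality is at
  most that of the reals and the set of points stays equipollent to the reals.\<close>

typedef omega1 = "{x :: wreal. countable {..x}}"
proof -
  have "uncountable {z :: wreal. countable {..z}}"
    using uncountable_initial_part[OF uncountable_wreal] by simp
  then have "{z :: wreal. countable {..z}} \<noteq> {}"
    by (rule contrapos_nn) simp
  then show ?thesis by blast
qed

instantiation omega1 :: wellorder
begin

definition less_eq_omega1 :: "omega1 \<Rightarrow> omega1 \<Rightarrow> bool" where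
  "less_eq_omega1 x y \<longleftrightarrow> Rep_omega1 x \<le> Rep_omega1 y"

definition less_omega1 :: "omega1 \<Rightarrow> omega1 \<Rightarrow> bool" where
  "less_omega1 x y \<longleftrightarrow> Rep_omega1 x < Rep_omega1 y"

instance
proof
  fix P :: "omega1 \<Rightarrow> bool" and a
  assume step: "\<And>x. (\<And>y. y < x \<Longrightarrow> P y) \<Longrightarrow> P x"
  have "\<forall>x. Rep_omega1 x = u \<longrightarrow> P x" for u
  proof (induction u rule: less_induct)
    case (less u)
    then show ?case
      using step unfolding less_omega1_def by blast
  qed
  then show "P a" by blast
next
  fix x y z :: omega1
  show "x < y \<longleftrightarrow> x \<le> y \<and> \<not> y \<le> x"
    unfolding less_eq_omega1_def less_omega1_def by (rule less_le_not_le)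
  show "x \<le> x"
    unfolding less_eq_omega1_def by (rule order_refl)
  show "x \<le> y \<Longrightarrow> y \<le> z \<Longrightarrow> x \<le> z"
    unfolding less_eq_omega1_def by (rule order_trans)
  show "x \<le> y \<Longrightarrow> y \<le> x \<Longrightarrow> x = y"
    unfolding less_eq_omega1_def by (simp add: Rep_omega1_inject[symmetric])
  show "x \<le> y \<or> y \<le> x"
    unfolding less_eq_omega1_def by (rule linear)
qed

end

lemma uncountable_omega1: "uncountable (UNIV :: omega1 set)"
proof
  assume "countable (UNIV :: omega1 set)"
  then have "countable (range Rep_omega1)"
    by simp
  then show False
    using uncountable_initial_part[OF uncountable_wreal]
      type_definition.Rep_range[OF type_definition_omega1] by simp
qed

lemma countable_atMost_omega1 [simp]: "countable {..i :: omega1}"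
proof -
  have "Rep_omega1 ` {..i} \<subseteq> {..Rep_omega1 i}"
    by (auto simp: less_eq_omega1_def)
  then have "countable (Rep_omega1 ` {..i})"
    using Rep_omega1[of i] countable_subset by blast
  then show ?thesis
    using countable_image_inj_on[of Rep_omega1] by (simp add: inj_on_def Rep_omega1_inject)
qed

lemma countable_strict_bound_omega1:
  fixes S :: "omega1 set"
  assumes "countable S"
  shows "\<exists>u. \<forall>y\<in>S. y < u"
proof (rule ccontr)
  assume "\<not> ?thesis"
  then have "UNIV \<subseteq> (\<Union>y\<in>S. {..y})"
    by (force simp: not_less)
  moreover have "countable (\<Union>y\<in>S. {..y})"
    using assms by simp
  ultimately show False
    using uncountable_omega1 countable_subset by blast
qed

section \<open>Values\<close>

text \<open>\<open>UNIV\<close> marks the points outside the support of a function; \<open>range Some\<close>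
  is the value of a maximal element at its point. Joins are not unions: a join of countable
  sets with uncountable union collapses to \<open>range Some\<close>, and only this step of the construction
  distinguishes countable from uncountable sets.\<close>

typedef cval = "{v :: omega1 option set. v = UNIV \<or> v = range Some \<or> None \<notin> v \<and> countable v}"
  by blast

text \<open>Closure under intersections makes the values a complete lattice, with suprema obtained
  as intersections of upper bounds.\<close>

lemma Inter_cval:
  assumes "\<And>v. v \<in> A \<Longrightarrow> v = UNIV \<or> v = range Some \<or> None \<notin> v \<and> countable v"
  shows "\<Inter>A = UNIV \<or> \<Inter>A = range Some \<or> None \<notin> \<Inter>A \<and> countable (\<Inter>A :: 'a option set)"
proof (cases "\<exists>v\<in>A. None \<notin> v \<and> countable v")
  case True
  then obtain v where "v \<in> A" "None \<notin> v" "countable v" by blast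
  then show ?thesis
    using countable_subset[of "\<Inter>A" v] by blast
next
  case False
  then have all: "v = UNIV \<or> v = range Some" if "v \<in> A" for v
    using assms that by blast
  show ?thesis
  proof (cases "range Some \<in> A")
    case True
    have "\<Inter>A = range Some"
    proof
      show "range Some \<subseteq> \<Inter>A" using all by blast
    qed (use True in blast)
    then show ?thesis by blast
  next
    case False
    then have "A \<subseteq> {UNIV}" using all by blast
    then have "\<Inter>A = UNIV" by (auto simp: subset_singleton_iff)
    then show ?thesis by simp
  qed
qed

instantiation cval :: complete_lattice
begin

definition less_eq_cval :: "cval \<Rightarrow> cval \<Rightarrow> bool" where
  "less_eq_cval v w \<longleftrightarrow> Rep_cval v \<subseteq> Rep_cval w"

definition less_cval :: "cval \<Rightarrow> cval \<Rightarrow> bool" where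
  "less_cval v w \<longleftrightarrow> Rep_cval v \<subset> Rep_cval w"

definition Inf_cval :: "cval set \<Rightarrow> cval" where
  "Inf_cval A = Abs_cval (\<Inter>(Rep_cval ` A))"

definition Sup_cval :: "cval set \<Rightarrow> cval" where
  "Sup_cval A = Inf {u. \<forall>v\<in>A. v \<le> u}"

definition inf_cval :: "cval \<Rightarrow> cval \<Rightarrow> cval" where
  "inf_cval v w = Inf {v, w}"

definition sup_cval :: "cval \<Rightarrow> cval \<Rightarrow> cval" where
  "sup_cval v w = Sup {v, w}"

definition bot_cval :: cval where
  "bot_cval = Sup {}"

definition top_cval :: cval where
  "top_cval = Inf {}"

instance
proof
  have Rep_Inf: "Rep_cval (Inf A) = \<Inter>(Rep_cval ` A)" for A
    unfolding Inf_cval_def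
  proof (rule Abs_cval_inverse, unfold mem_Collect_eq, rule Inter_cval)
    fix v assume "v \<in> Rep_cval ` A"
    then obtain u where "v = Rep_cval u" by blast
    then show "v = UNIV \<or> v = range Some \<or> None \<notin> v \<and> countable v"
      using Rep_cval[of u] by simp
  qed
  show Inf_lower: "v \<in> A \<Longrightarrow> Inf A \<le> v" for v :: cval and A
    by (auto simp: less_eq_cval_def Rep_Inf)
  show Inf_greatest: "(\<And>v. v \<in> A \<Longrightarrow> u \<le> v) \<Longrightarrow> u \<le> Inf A" for u :: cval and A
    by (auto simp: less_eq_cval_def Rep_Inf)
  show Sup_upper: "v \<in> A \<Longrightarrow> v \<le> Sup A" for v :: cval and A
    unfolding Sup_cval_def by (rule Inf_greatest) blast
  show Sup_least: "(\<And>v. v \<in> A \<Longrightarrow> v \<le> u) \<Longrightarrow> Sup A \<le> u" for u :: cval and A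
    unfolding Sup_cval_def by (rule Inf_lower) blast
  fix u v w :: cval
  show "v < w \<longleftrightarrow> v \<le> w \<and> \<not> w \<le> v"
    by (auto simp: less_eq_cval_def less_cval_def)
  show "v \<le> v" "u \<le> v \<Longrightarrow> v \<le> w \<Longrightarrow> u \<le> w"
    by (auto simp: less_eq_cval_def)
  show "v \<le> w \<Longrightarrow> w \<le> v \<Longrightarrow> v = w"
    unfolding less_eq_cval_def by (simp add: Rep_cval_inject[symmetric])
  show "inf v w \<le> v" "inf v w \<le> w"
    unfolding inf_cval_def by (simp_all add: Inf_lower)
  show "u \<le> v \<Longrightarrow> u \<le> w \<Longrightarrow> u \<le> inf v w"
    unfolding inf_cval_def by (rule Inf_greatest) blast
  show "v \<le> sup v w" "w \<le> sup v w"
    unfolding sup_cval_def by (simp_all add: Sup_upper)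
  show "v \<le> u \<Longrightarrow> w \<le> u \<Longrightarrow> sup v w \<le> u"
    unfolding sup_cval_def by (rule Sup_least) blast
  show "Inf {} = (top :: cval)" "Sup {} = (bot :: cval)"
    by (simp_all add: top_cval_def bot_cval_def)
qed

end

lemma Rep_top_cval: "Rep_cval top = UNIV"
  unfolding top_cval_def Inf_cval_def by (simp add: Abs_cval_inverse)

definition full_val :: cval where
  "full_val = Abs_cval (range Some)"

text \<open>The least countable ordinal serves as a separate bit: it belongs to
  \<open>full_val\<close> and to every \<open>upto_val i\<close>, but to no
  \<open>rank_val i\<close>.\<close>

definition least_val :: cval where
  "least_val = Abs_cval {Some (LEAST i. True)}"

definition upto_val :: "omega1 \<Rightarrow> cval" where
  "upto_val i = Abs_cval (Some ` {..i})"

definition rank_val :: "omega1 \<Rightarrow> cval" where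
  "rank_val i = Abs_cval (Some ` {(LEAST i. True)<..i})"

lemma Rep_full_val: "Rep_cval full_val = range Some"
  unfolding full_val_def by (rule Abs_cval_inverse) simp

lemma Rep_least_val: "Rep_cval least_val = {Some (LEAST i. True)}"
  unfolding least_val_def by (rule Abs_cval_inverse) simp

lemma Rep_upto_val: "Rep_cval (upto_val i) = Some ` {..i}"
  unfolding upto_val_def by (rule Abs_cval_inverse) auto

lemma countable_greaterThanAtMost_omega1: "countable {j<..i :: omega1}"
  by (rule countable_subset[OF _ countable_atMost_omega1[of i]]) auto

lemma Rep_rank_val: "Rep_cval (rank_val i) = Some ` {(LEAST i. True)<..i}"
  unfolding rank_val_def
  by (rule Abs_cval_inverse) (auto simp: countable_greaterThanAtMost_omega1)

lemmas Rep_val = Rep_top_cval Rep_full_val Rep_least_val Rep_upto_val Rep_rank_val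

lemma None_in_cval_iff: "None \<in> Rep_cval v \<longleftrightarrow> v = top"
  using Rep_cval[of v] Rep_cval_inject[of v top] by (auto simp: Rep_top_cval)

lemma full_val_neq_top: "full_val \<noteq> top"
  using None_in_cval_iff[of full_val] by (auto simp: Rep_full_val)

lemma le_full_val:
  assumes "v \<noteq> top"
  shows "v \<le> full_val"
proof -
  have "None \<notin> Rep_cval v"
    using assms by (simp add: None_in_cval_iff)
  then have "x \<in> range Some" if "x \<in> Rep_cval v" for x
    using that by (cases x) auto
  then show ?thesis
    by (auto simp: less_eq_cval_def Rep_full_val)
qed

lemma least_val_le: "least_val \<le> full_val" "least_val \<le> upto_val i"
  by (auto simp: less_eq_cval_def Rep_val Least_le)

lemma least_val_not_le: "\<not> least_val \<le> rank_val i"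
  by (auto simp: less_eq_cval_def Rep_val)

lemma rank_val_le:
  "i \<le> j \<Longrightarrow> rank_val i \<le> rank_val j"
  "i \<le> j \<Longrightarrow> rank_val i \<le> upto_val j"
  "rank_val i \<le> full_val"
  by (auto simp: less_eq_cval_def Rep_val)

lemma upto_val_less_full: "upto_val i < full_val"
proof -
  have "{..i} \<noteq> UNIV"
    using uncountable_omega1 countable_atMost_omega1[of i] by metis
  then have "Some ` {..i} \<noteq> range Some"
    by (simp add: inj_image_eq_iff)
  then show ?thesis
    by (auto simp: less_cval_def Rep_val)
qed

text \<open>The ranks together contain uncountably many ordinals, and the only values that large are
  \<open>range Some\<close> and \<open>UNIV\<close>. The bit omitted by every single rank thus
  reappears in the supremum.\<close>

lemma Sup_rank_val: "Sup (range rank_val) = full_val"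
proof (rule antisym)
  show "Sup (range rank_val) \<le> full_val"
    by (rule Sup_least) (auto simp: rank_val_le)
  let ?S = "Rep_cval (Sup (range rank_val))" and ?z = "LEAST i :: omega1. True"
  have "Some i \<in> ?S" if "i \<noteq> ?z" for i
  proof -
    have "Some i \<in> Rep_cval (rank_val i)"
      using that Least_le[of "\<lambda>i :: omega1. True" i] by (auto simp: Rep_val)
    moreover have "rank_val i \<le> Sup (range rank_val)"
      by (rule Sup_upper) simp
    ultimately show ?thesis
      unfolding less_eq_cval_def by blast
  qed
  then have sub: "Some ` (UNIV - {?z}) \<subseteq> ?S" by blast
  have "uncountable (UNIV - {?z})"
    using uncountable_omega1 by (simp add: uncountable_minus_countable)
  then have "uncountable (Some ` (UNIV - {?z}))"
    using countable_image_inj_eq[of Some "UNIV - {?z}"] by simp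
  then have "uncountable ?S"
    by (rule contrapos_nn) (rule countable_subset[OF sub])
  then have "?S = UNIV \<or> ?S = range Some"
    using Rep_cval[of "Sup (range rank_val)"] by simp
  then have "range Some \<subseteq> ?S" by blast
  then show "full_val \<le> Sup (range rank_val)"
    by (simp add: less_eq_cval_def Rep_full_val)
qed

section \<open>Posets of partial functions generated by tokens\<close>

definition peak :: "'x \<Rightarrow> 'v \<Rightarrow> 'x \<Rightarrow> 'v::complete_lattice" where
  "peak x v = (\<lambda>y. if y = x then v else top)"

text \<open>A point \<open>x\<close> belongs to \<open>supp \<phi>\<close> iff some
  \<open>peak x v\<close> with \<open>v \<noteq> top\<close> lies above \<open>\<phi>\<close>. Going
  up shrinks the support, so boundedness of a set amounts to a nonempty support of its join.\<close>

definition supp :: "('x \<Rightarrow> 'v::complete_lattice) \<Rightarrow> 'x set" where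
  "supp \<phi> = {x. \<phi> x \<noteq> top}"

definition token :: "'v::complete_lattice \<Rightarrow> 'x set \<Rightarrow> 'x \<Rightarrow> 'v \<Rightarrow> 'x \<Rightarrow> 'v" where
  "token r s x v = (\<lambda>y. if y = x then v else if y \<in> s then r else top)"

lemma supp_peak: "supp (peak x v) \<subseteq> {x}"
  by (auto simp: supp_def peak_def)

lemma supp_token: "supp (token r s x v) \<subseteq> insert x s"
  by (auto simp: supp_def token_def)

lemma neq_top_if_le: "v \<le> w \<Longrightarrow> w \<noteq> top \<Longrightarrow> v \<noteq> (top :: 'v::complete_lattice)"
  by (auto simp: top.extremum_unique)

lemma supp_antimono: "\<phi> \<le> \<psi> \<Longrightarrow> supp \<psi> \<subseteq> supp \<phi>"
  by (auto simp: supp_def le_fun_def dest: neq_top_if_le)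

lemma le_peak_iff: "\<phi> \<le> peak x v \<longleftrightarrow> \<phi> x \<le> v"
  by (auto simp: le_fun_def peak_def)

text \<open>A rule \<open>(s, x, v)\<close> makes the value \<open>v\<close> at \<open>x\<close> a directed supremum of tokens over the cofinite
  subsets of \<open>s\<close>. Hence a Scott closed set containing \<open>peak y r\<close> for infinitely many \<open>y \<in> s\<close>
  contains \<open>peak x v\<close>.\<close>

locale token_system =
  fixes S :: "('x set \<times> 'x \<times> 'v::complete_lattice) set" and r full :: 'v
  assumes almost_disjoint: "\<And>\<sigma> \<tau>. \<sigma> \<in> S \<Longrightarrow> \<tau> \<in> S \<Longrightarrow> \<sigma> \<noteq> \<tau> \<Longrightarrow> finite (fst \<sigma> \<inter> fst \<tau>)"
    and full_neq_top: "full \<noteq> top"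
    and le_full: "\<And>v. v \<noteq> top \<Longrightarrow> v \<le> full"
    and r_neq_top: "r \<noteq> top"
    and val_neq_top: "\<And>s x v. (s, x, v) \<in> S \<Longrightarrow> v \<noteq> top"
begin

text \<open>Finite supports admit arbitrary values, so joins whose support becomes finite and
  nonempty stay inside. The subsets \<open>s'\<close> provide the cofinite parts of \<open>s\<close>
  and the joins of tokens of one rule.\<close>

definition elems :: "('x \<Rightarrow> 'v) set" where
  "elems = {\<phi>. supp \<phi> \<noteq> {} \<and>
        (finite (supp \<phi>) \<or> (\<exists>(s, x, v)\<in>S. \<exists>s'\<subseteq>s. \<phi> = token r s' x v))}"

definition token_poset :: "('x \<Rightarrow> 'v) gorder" where
  "token_poset = \<lparr>carrier = elems, eq = (=), le = (\<le>)\<rparr>"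

lemma token_poset_simps [simp]:
  "carrier token_poset = elems"
  "x .=\<^bsub>token_poset\<^esub> y \<longleftrightarrow> x = y"
  "x \<sqsubseteq>\<^bsub>token_poset\<^esub> y \<longleftrightarrow> x \<le> y"
  by (auto simp: token_poset_def)

lemma partial_order_token_poset: "partial_order token_poset"
  by unfold_locales (auto simp: token_poset_def)

lemma neq_top_iff: "v \<noteq> top \<longleftrightarrow> v \<le> full"
  using le_full neq_top_if_le[OF _ full_neq_top] by blast

lemma peak_in_elems: "v \<noteq> top \<Longrightarrow> peak x v \<in> elems"
  using supp_peak[of x v] finite_subset[OF supp_peak[of x v]] by (auto simp: elems_def supp_def peak_def)

lemma token_in_elems:
  assumes "(s, x, v) \<in> S" "s' \<subseteq> s"
  shows "token r s' x v \<in> elems"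
proof -
  have "x \<in> supp (token r s' x v)"
    using val_neq_top[OF assms(1)] by (simp add: supp_def token_def)
  then have "supp (token r s' x v) \<noteq> {}" by blast
  moreover have "\<exists>(t, y, w)\<in>S. \<exists>t'\<subseteq>t. token r s' x v = token r t' y w"
    by (rule bexI[OF _ assms(1)]) (use assms(2) in auto)
  ultimately show ?thesis
    unfolding elems_def by (intro CollectI conjI disjI2)
qed

lemma is_lubI: "A \<subseteq> elems \<Longrightarrow> Sup A \<in> elems \<Longrightarrow> is_lub token_poset (Sup A) A"
  by (auto simp: least_def Upper_def intro: Sup_upper Sup_least)

lemma is_lub_eq: "A \<subseteq> elems \<Longrightarrow> Sup A \<in> elems \<Longrightarrow> is_lub token_poset s A \<Longrightarrow> s = Sup A"
  by (rule partial_order.least_unique[OF partial_order_token_poset _ is_lubI])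

lemma infinite_supp_token:
  assumes "\<phi> \<in> elems" "infinite (supp \<phi>)"
  obtains s x v s' where "(s, x, v) \<in> S" "s' \<subseteq> s" "\<phi> = token r s' x v"
proof -
  have "\<exists>(s, x, v)\<in>S. \<exists>s'\<subseteq>s. \<phi> = token r s' x v"
    using assms by (simp add: elems_def)
  then show ?thesis using that by auto
qed

text \<open>If the join has infinite support, any two members of \<open>A\<close> share infinitely
  many support points, so almost disjointness forces them to be tokens of one and the same rule;
  their join is then again a token of it. This serves both bounded and directed sets.\<close>

lemma Sup_in_elems:
  assumes A: "A \<subseteq> elems" and ne: "A \<noteq> {}" and supp: "supp (Sup A) \<noteq> {}"
  shows "Sup A \<in> elems"
proof (cases "finite (supp (Sup A))")
  case True
  with supp show ?thesis by (simp add: elems_def)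
next
  case False
  have inf: "infinite (supp \<phi> \<inter> supp \<psi>)" if "\<phi> \<in> A" "\<psi> \<in> A" for \<phi> \<psi>
    using False supp_antimono[OF Sup_upper[OF that(1)]] supp_antimono[OF Sup_upper[OF that(2)]]
      finite_subset[of "supp (Sup A)" "supp \<phi> \<inter> supp \<psi>"] by blast
  obtain \<phi> where \<phi>: "\<phi> \<in> A" using ne by blast
  have "infinite (supp \<psi>)" if "\<psi> \<in> A" for \<psi>
    using inf[OF that that] by simp
  note tok = infinite_supp_token[OF subsetD[OF A] this]
  obtain s x v s0 where s: "(s, x, v) \<in> S" "s0 \<subseteq> s" "\<phi> = token r s0 x v"
    using tok[OF \<phi> \<phi>] by blast
  have all: "\<exists>s'\<subseteq>s. \<psi> = token r s' x v" if \<psi>: "\<psi> \<in> A" for \<psi>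
  proof -
    obtain t y w t0 where t: "(t, y, w) \<in> S" "t0 \<subseteq> t" "\<psi> = token r t0 y w"
      using tok[OF \<psi> \<psi>] by blast
    have "supp \<phi> \<inter> supp \<psi> \<subseteq> insert x (insert y (s \<inter> t))"
      using s t supp_token[of r s0 x v] supp_token[of r t0 y w] by auto
    then have "infinite (insert x (insert y (s \<inter> t)))"
      using inf[OF \<phi> \<psi>] by (rule infinite_super)
    then have "infinite (s \<inter> t)" by simp
    then have "(t, y, w) = (s, x, v)"
      using almost_disjoint[OF t(1) s(1)] by (auto simp: Int_commute)
    with t show ?thesis by blast
  qed
  let ?s = "{y. y \<noteq> x \<and> Sup A y \<noteq> top}"
  have at_x: "\<psi> x = v" if "\<psi> \<in> A" for \<psi>
    using all[OF that] by (auto simp: token_def)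
  have eq: "Sup A = token r ?s x v"
  proof (rule ext)
    fix y
    consider "y = x" | "y \<noteq> x" "Sup A y = top" | "y \<noteq> x" "Sup A y \<noteq> top" by blast
    then show "Sup A y = token r ?s x v y"
    proof cases
      case 1
      have "(\<lambda>\<psi>. \<psi> x) ` A = {v}" using at_x ne by auto
      then show ?thesis using 1 by (simp add: Sup_apply token_def)
    next
      case 3
      have "\<psi> y = r" if "\<psi> \<in> A" for \<psi>
      proof -
        have "\<psi> y \<noteq> top"
          using neq_top_if_le[OF le_funD[OF Sup_upper[OF that]] 3(2)] .
        then show ?thesis
          using all[OF that] 3 by (auto simp: token_def split: if_splits)
      qed
      then have "(\<lambda>\<psi>. \<psi> y) ` A = {r}" using ne by auto
      then show ?thesis using 3 by (simp add: Sup_apply token_def)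
    qed (simp add: token_def)
  qed
  have sub: "?s \<subseteq> s"
  proof
    fix y assume y: "y \<in> ?s"
    have "\<phi> y \<noteq> top"
      using neq_top_if_le[OF le_funD[OF Sup_upper[OF \<phi>]]] y by blast
    then show "y \<in> s" using s y by (auto simp: token_def split: if_splits)
  qed
  show ?thesis
    by (subst eq) (rule token_in_elems[OF s(1) sub])
qed

lemma directed_token_poset_iff:
  "directed token_poset D \<longleftrightarrow> D \<subseteq> elems \<and> D \<noteq> {} \<and> (\<forall>\<phi>\<in>D. \<forall>\<psi>\<in>D. \<exists>\<theta>\<in>D. \<phi> \<le> \<theta> \<and> \<psi> \<le> \<theta>)"
  by (auto simp: directed_def)

lemma directedE:
  assumes "directed token_poset D" "\<phi> \<in> D" "\<psi> \<in> D"
  obtains \<theta> where "\<theta> \<in> D" "\<phi> \<le> \<theta>" "\<psi> \<le> \<theta>"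
  using assms unfolding directed_token_poset_iff by blast

lemma directed_finite_upper:
  assumes D: "directed token_poset D" and "finite F" "F \<subseteq> D"
  shows "\<exists>\<theta>\<in>D. \<forall>\<phi>\<in>F. \<phi> \<le> \<theta>"
  using assms(2,3)
proof (induction F)
  case empty
  then show ?case using D by (auto simp: directed_token_poset_iff)
next
  case (insert \<phi> F)
  then obtain \<theta> where "\<theta> \<in> D" "\<forall>\<phi>\<in>F. \<phi> \<le> \<theta>" by auto
  moreover from insert have "\<phi> \<in> D" by simp
  ultimately obtain \<omega> where "\<omega> \<in> D" "\<phi> \<le> \<omega>" "\<theta> \<le> \<omega>"
    using directedE[OF D] by blast
  with \<open>\<forall>\<phi>\<in>F. \<phi> \<le> \<theta>\<close> show ?case
    by (intro bexI[of _ \<omega>]) (auto intro: order_trans)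
qed

text \<open>If each \<open>y\<close> in \<open>B\<close> failed at some member of \<open>D\<close>,
  an upper bound in \<open>D\<close> of these finitely many members would fail on all of
  \<open>B\<close>.\<close>

lemma directed_finite_choice:
  assumes D: "directed token_poset D" and B: "finite B" "\<And>\<phi>. \<phi> \<in> D \<Longrightarrow> \<exists>y\<in>B. \<phi> y \<le> \<kappa> y"
  shows "\<exists>y\<in>B. Sup D y \<le> \<kappa> y"
proof (rule ccontr)
  assume neg: "\<not> ?thesis"
  have "\<exists>\<phi>\<in>D. \<not> \<phi> y \<le> \<kappa> y" if y: "y \<in> B" for y
  proof (rule ccontr)
    assume "\<not> ?thesis"
    then have "Sup D y \<le> \<kappa> y" by (auto intro: Sup_least)
    with neg y show False by blast
  qed
  then obtain f where f: "\<And>y. y \<in> B \<Longrightarrow> f y \<in> D \<and> \<not> f y y \<le> \<kappa> y"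
    by metis
  obtain \<theta> where \<theta>: "\<theta> \<in> D" "\<forall>\<phi>\<in>f ` B. \<phi> \<le> \<theta>"
    using directed_finite_upper[OF D, of "f ` B"] B(1) f by blast
  obtain y where "y \<in> B" "\<theta> y \<le> \<kappa> y"
    using B(2)[OF \<theta>(1)] by blast
  then show False
    using f[of y] \<theta>(2) order_trans[OF le_funD[of "f y" \<theta> y]] by blast
qed

text \<open>Almost disjointness makes the supports compact: this is what prevents a directed set of
  tokens from losing all of its maximal upper bounds.\<close>

lemma directed_Sup_le:
  assumes D: "directed token_poset D" and \<kappa>: "\<And>y. \<kappa> y \<noteq> top"
    and ex: "\<And>\<phi>. \<phi> \<in> D \<Longrightarrow> \<exists>y. \<phi> y \<le> \<kappa> y"
    and hit: "\<And>s x v. (s, x, v) \<in> S \<Longrightarrow> infinite {y \<in> s. r \<le> \<kappa> y} \<Longrightarrow> v \<le> \<kappa> x"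
  shows "\<exists>y. Sup D y \<le> \<kappa> y"
proof (cases "\<exists>\<phi>\<in>D. finite (supp \<phi>)")
  case True
  then obtain \<phi> where \<phi>: "\<phi> \<in> D" "finite (supp \<phi>)" by blast
  \<comment> \<open>Members above \<open>\<phi>\<close> have their support inside
    \<open>supp \<phi>\<close>, which confines the witnesses to a finite set.\<close>
  have "\<exists>y\<in>supp \<phi>. \<psi> y \<le> \<kappa> y" if \<psi>: "\<psi> \<in> D" for \<psi>
  proof -
    obtain \<theta> where \<theta>: "\<theta> \<in> D" "\<phi> \<le> \<theta>" "\<psi> \<le> \<theta>"
      using directedE[OF D _ \<psi>] \<phi> by blast
    obtain y where y: "\<theta> y \<le> \<kappa> y" using ex[OF \<theta>(1)] by blast
    then have "\<theta> y \<noteq> top" using neq_top_if_le \<kappa> by blast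
    then have "y \<in> supp \<phi>" using supp_antimono[OF \<theta>(2)] by (auto simp: supp_def)
    moreover have "\<psi> y \<le> \<kappa> y" using le_funD[OF \<theta>(3)] y by (rule order_trans)
    ultimately show ?thesis by blast
  qed
  then show ?thesis
    using directed_finite_choice[OF D \<phi>(2)] by blast
next
  case False
  obtain \<phi> where \<phi>: "\<phi> \<in> D" using D by (auto simp: directed_token_poset_iff)
  have DC: "D \<subseteq> elems" using D by (auto simp: directed_token_poset_iff)
  obtain s x v s0 where s: "(s, x, v) \<in> S" "s0 \<subseteq> s" "\<phi> = token r s0 x v"
    using infinite_supp_token[of \<phi>] \<phi> DC False by blast
  have all: "\<exists>s'\<subseteq>s. \<psi> = token r s' x v" if \<psi>: "\<psi> \<in> D" for \<psi>
  proof -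
    obtain t y w t0 where t: "(t, y, w) \<in> S" "t0 \<subseteq> t" "\<psi> = token r t0 y w"
      using infinite_supp_token[of \<psi>] \<psi> DC False by blast
    obtain \<theta> where \<theta>: "\<theta> \<in> D" "\<phi> \<le> \<theta>" "\<psi> \<le> \<theta>"
      using directedE[OF D _ \<psi>] \<phi> by blast
    have "supp \<theta> \<subseteq> insert x (insert y (s \<inter> t))"
      using s t supp_token[of r s0 x v] supp_token[of r t0 y w]
        supp_antimono[OF \<theta>(2)] supp_antimono[OF \<theta>(3)] by auto
    moreover have "infinite (supp \<theta>)" using False \<theta>(1) by blast
    ultimately have "infinite (insert x (insert y (s \<inter> t)))"
      by (rule infinite_super)
    then have "infinite (s \<inter> t)" by simp
    then have "(t, y, w) = (s, x, v)"
      using almost_disjoint[OF t(1) s(1)] by (auto simp: Int_commute)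
    with t show ?thesis by blast
  qed
  show ?thesis
  proof (cases "v \<le> \<kappa> x")
    case True
    have "\<psi> x = v" if "\<psi> \<in> D" for \<psi>
      using all[OF that] by (auto simp: token_def)
    then have "Sup D x \<le> v" by (auto intro: Sup_least)
    with True show ?thesis using order_trans by blast
  next
    case not_le: False
    let ?B = "{y \<in> s. r \<le> \<kappa> y}"
    \<comment> \<open>By contraposition of \<open>hit\<close>: as \<open>x\<close> is not a witness,
      only finitely many points of \<open>s\<close> can be, and the finite argument applies
      again.\<close>
    have "finite ?B" using hit[OF s(1)] not_le by blast
    moreover have "\<exists>y\<in>?B. \<psi> y \<le> \<kappa> y" if \<psi>: "\<psi> \<in> D" for \<psi>
    proof -
      obtain s' where s': "s' \<subseteq> s" "\<psi> = token r s' x v" using all[OF \<psi>] by blast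
      obtain y where y: "\<psi> y \<le> \<kappa> y" using ex[OF \<psi>] by blast
      have "y \<noteq> x" using y s' not_le by (auto simp: token_def)
      moreover have "\<psi> y \<noteq> top" using neq_top_if_le[OF y \<kappa>] .
      ultimately have "y \<in> s'" "\<psi> y = r" using s' by (auto simp: token_def split: if_splits)
      then show ?thesis using s' y by (intro bexI[of _ y]) auto
    qed
    ultimately show ?thesis
      using directed_finite_choice[OF D, of ?B \<kappa>] by blast
  qed
qed

text \<open>With \<open>\<kappa>\<close> constantly \<open>full\<close>, the inequality
  \<open>\<phi> y \<le> \<kappa> y\<close> says that \<open>y\<close> is in the support; directed
  joins therefore keep a nonempty support.\<close>

lemma directed_Sup_in_elems:
  assumes D: "directed token_poset D"
  shows "Sup D \<in> elems"
proof (rule Sup_in_elems)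
  show "D \<subseteq> elems" "D \<noteq> {}" using D by (auto simp: directed_token_poset_iff)
  have "\<exists>y. Sup D y \<le> full"
  proof (rule directed_Sup_le[OF D, of "\<lambda>_. full"])
    fix \<phi> assume "\<phi> \<in> D"
    then have "supp \<phi> \<noteq> {}"
      using D by (auto simp: directed_token_poset_iff elems_def)
    then show "\<exists>y. \<phi> y \<le> full"
      using le_full by (auto simp: supp_def)
  next
    show "v \<le> full" if "(s, x, v) \<in> S" for s x v
      using le_full[OF val_neq_top[OF that]] .
  qed (rule full_neq_top)
  then show "supp (Sup D) \<noteq> {}"
    using neq_top_iff by (auto simp: supp_def)
qed

lemma bounded_complete_dcpo: "bounded_complete_dcpo token_poset"
proof -
  interpret partial_order token_poset by (rule partial_order_token_poset)
  show ?thesis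
  proof unfold_locales
    show "\<exists>s. is_lub token_poset s D" if "directed token_poset D" for D
      using is_lubI[OF _ directed_Sup_in_elems[OF that]] that
      by (auto simp: directed_token_poset_iff)
  next
    fix A u
    assume A: "A \<subseteq> carrier token_poset" "A \<noteq> {}" and u: "u \<in> carrier token_poset"
      and le: "\<And>x. x \<in> A \<Longrightarrow> x \<sqsubseteq>\<^bsub>token_poset\<^esub> u"
    have "Sup A \<le> u" using le by (auto intro: Sup_least)
    then have "supp (Sup A) \<noteq> {}"
      using u supp_antimono by (fastforce simp: elems_def)
    then show "\<exists>s. is_lub token_poset s A"
      using is_lubI[of A] Sup_in_elems[of A] A by auto
  qed
qed

lemma Max_elements_token_poset: "Max_elements token_poset = range (\<lambda>x :: 'x. peak x full)"
proof (intro equalityI subsetI)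
  fix \<phi> assume \<phi>: "\<phi> \<in> Max_elements token_poset"
  then obtain x where "\<phi> x \<noteq> top" by (auto simp: Max_elements_def elems_def supp_def)
  then have "\<phi> \<le> peak x full" by (simp add: le_peak_iff le_full)
  then show "\<phi> \<in> range (\<lambda>x :: 'x. peak x full)"
    using \<phi> peak_in_elems[OF full_neq_top, of x] by (auto simp: Max_elements_def)
next
  fix \<phi> assume "\<phi> \<in> range (\<lambda>x :: 'x. peak x full)"
  then obtain x where x: "\<phi> = peak x full" by blast
  have "\<psi> = \<phi>" if \<psi>: "\<psi> \<in> elems" "\<phi> \<le> \<psi>" for \<psi>
  proof -
    have sub: "supp \<psi> \<subseteq> {x}"
      using supp_antimono[OF \<psi>(2)] supp_peak[of x full] x by blast
    then have "\<psi> x \<noteq> top" using \<psi>(1) by (auto simp: elems_def supp_def)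
    then have "\<psi> x = full"
      using le_full[of "\<psi> x"] le_funD[OF \<psi>(2), of x] x by (simp add: peak_def)
    then show ?thesis
      using sub x by (fastforce simp: peak_def supp_def)
  qed
  then show "\<phi> \<in> Max_elements token_poset"
    using peak_in_elems[OF full_neq_top] x by (auto simp: Max_elements_def)
qed

text \<open>The complement is the down-set of the elements \<open>peak y (\<kappa> y)\<close>. The
  assumption \<open>hit\<close> states that \<open>\<kappa>\<close> is stable under the rules, which
  closes this down-set under directed suprema.\<close>

lemma scott_open_avoiding:
  assumes \<kappa>: "\<And>y. \<kappa> y \<noteq> top"
    and hit: "\<And>s x v. (s, x, v) \<in> S \<Longrightarrow> infinite {y \<in> s. r \<le> \<kappa> y} \<Longrightarrow> v \<le> \<kappa> x"
  shows "scott_open token_poset {\<phi> \<in> elems. \<forall>y. \<not> \<phi> y \<le> \<kappa> y}" (is "scott_open token_poset ?U")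
  unfolding scott_open_def
proof (intro conjI allI impI ballI)
  fix D s assume D: "directed token_poset D \<and> is_lub token_poset s D \<and> s \<in> ?U"
  then have "s = Sup D"
    using is_lub_eq[OF _ directed_Sup_in_elems] by (auto simp: directed_token_poset_iff)
  then show "D \<inter> ?U \<noteq> {}"
    using directed_Sup_le[of D \<kappa>, OF _ \<kappa> _ hit] D by (fastforce simp: directed_token_poset_iff)
next
  fix \<phi> \<psi> :: "'x \<Rightarrow> 'v" assume "\<phi> \<in> ?U" "\<psi> \<in> carrier token_poset" "\<phi> \<sqsubseteq>\<^bsub>token_poset\<^esub> \<psi>"
  then show "\<psi> \<in> ?U"
    using order_trans[OF le_funD[of \<phi> \<psi>]] by auto
qed auto

lemma scott_open_upD: "scott_open token_poset U \<Longrightarrow> \<phi> \<in> U \<Longrightarrow> \<phi> \<le> \<psi> \<Longrightarrow> \<psi> \<in> elems \<Longrightarrow> \<psi> \<in> U"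
  unfolding scott_open_def by auto

text \<open>\<open>peak x v\<close> is the directed supremum of the tokens over \<open>s - F\<close>
  for finite \<open>F\<close>, so one of these lies in \<open>U\<close>; it is below
  \<open>peak y r\<close> for all but finitely many \<open>y\<close> in \<open>s\<close>.\<close>

lemma scott_open_peak_target:
  assumes U: "scott_open token_poset U" and s: "(s, x, v) \<in> S" and x: "peak x v \<in> U"
  shows "finite {y \<in> s. peak y r \<notin> U}"
proof (rule ccontr)
  assume inf: "infinite {y \<in> s. peak y r \<notin> U}"
  let ?D = "(\<lambda>F. token r (s - F) x v) ` {F. finite F}"
  have DC: "?D \<subseteq> elems" using token_in_elems[OF s] by auto
  have mono: "token r (s - F) x v \<le> token r (s - G) x v" if "F \<subseteq> G" for F G
    using that by (auto simp: token_def le_fun_def)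
  have "directed token_poset ?D"
    unfolding directed_token_poset_iff
  proof (intro conjI ballI DC)
    fix \<phi> \<psi> assume "\<phi> \<in> ?D" "\<psi> \<in> ?D"
    then obtain F G where "finite F" "finite G" "\<phi> = token r (s - F) x v" "\<psi> = token r (s - G) x v"
      by blast
    then show "\<exists>\<theta>\<in>?D. \<phi> \<le> \<theta> \<and> \<psi> \<le> \<theta>"
      by (intro bexI[of _ "token r (s - (F \<union> G)) x v"]) (auto intro!: mono)
  qed auto
  moreover have "Sup ?D = peak x v"
  proof (rule antisym)
    show "Sup ?D \<le> peak x v"
      by (rule Sup_least) (auto simp: le_peak_iff token_def)
    show "peak x v \<le> Sup ?D"
    proof (rule le_funI)
      fix y
      have "peak x v y \<le> token r (s - {y}) x v y" by (auto simp: peak_def token_def)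
      also have "\<dots> \<le> Sup ?D y"
        by (rule le_funD[OF Sup_upper[of "token r (s - {y}) x v" ?D]]) (rule image_eqI[OF refl], simp)
      finally show "peak x v y \<le> Sup ?D y" .
    qed
  qed
  moreover have "is_lub token_poset (Sup ?D) ?D"
    using is_lubI[OF DC] peak_in_elems[OF val_neq_top[OF s], of x] calculation(2) by simp
  ultimately have "?D \<inter> U \<noteq> {}"
    using U x unfolding scott_open_def by metis
  then obtain F where F: "finite F" "token r (s - F) x v \<in> U" by blast
  \<comment> \<open>The point \<open>x\<close> is removed along with \<open>F\<close> because the
    token has value \<open>v\<close> there instead of \<open>r\<close>.\<close>
  have "infinite ({y \<in> s. peak y r \<notin> U} - insert x F)"
    using inf F(1) by simp
  then have "{y \<in> s. peak y r \<notin> U} - insert x F \<noteq> {}"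
    by (rule infinite_imp_nonempty)
  then obtain y where y: "y \<in> s" "peak y r \<notin> U" "y \<noteq> x" "y \<notin> F" by blast
  then have "token r (s - F) x v \<le> peak y r"
    by (auto simp: le_peak_iff token_def)
  then show False
    using scott_open_upD[OF U F(2)] peak_in_elems[OF r_neq_top] y(2) by blast
qed

lemma scott_open_peak_Sup:
  assumes U: "scott_open token_poset U" and I: "I \<noteq> {}" "\<And>v w. v \<in> I \<Longrightarrow> w \<in> I \<Longrightarrow> \<exists>u\<in>I. v \<le> u \<and> w \<le> u"
    and top: "Sup I \<noteq> top" and x: "peak x (Sup I) \<in> U"
  shows "\<exists>v\<in>I. peak x v \<in> U"
proof -
  let ?D = "peak x ` I"
  have I_top: "v \<noteq> top" if "v \<in> I" for v
    using neq_top_if_le[OF Sup_upper[OF that] top] .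
  have DC: "?D \<subseteq> elems" using peak_in_elems I_top by blast
  have "directed token_poset ?D"
    unfolding directed_token_poset_iff
  proof (intro conjI ballI DC)
    fix \<phi> \<psi> assume "\<phi> \<in> ?D" "\<psi> \<in> ?D"
    then obtain v w where "v \<in> I" "w \<in> I" and eq: "\<phi> = peak x v" "\<psi> = peak x w" by blast
    then obtain u where "u \<in> I" "v \<le> u" "w \<le> u" using I(2) by blast
    then show "\<exists>\<theta>\<in>?D. \<phi> \<le> \<theta> \<and> \<psi> \<le> \<theta>"
      unfolding eq by (intro bexI[of _ "peak x u"]) (auto simp: le_fun_def peak_def)
  qed (use I(1) in simp)
  moreover have "Sup ?D = peak x (Sup I)"
  proof (rule antisym)
    show "Sup ?D \<le> peak x (Sup I)"
      by (rule Sup_least) (auto simp: le_fun_def peak_def Sup_upper)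
    show "peak x (Sup I) \<le> Sup ?D"
      using I(1) by (auto simp: le_fun_def peak_def image_image)
  qed
  moreover have "is_lub token_poset (Sup ?D) ?D"
    using is_lubI[OF DC] peak_in_elems[OF top, of x] calculation(2) by simp
  ultimately have "?D \<inter> U \<noteq> {}"
    using U x unfolding scott_open_def by metis
  then show ?thesis by blast
qed

end

section \<open>Transport along an injection\<close>

text \<open>The token poset consists of functions on points, while the final statement fixes the
  type of the carrier; this copies the poset into that type.\<close>

definition transport :: "('a \<Rightarrow> 'b) \<Rightarrow> 'a gorder \<Rightarrow> 'b gorder" where
  "transport f P = \<lparr>carrier = f ` carrier P, eq = (=),
     le = (\<lambda>a b. inv f a \<sqsubseteq>\<^bsub>P\<^esub> inv f b)\<rparr>"

lemma Upper_eq: "A \<subseteq> carrier Q \<Longrightarrow> Upper Q A = {u \<in> carrier Q. \<forall>x\<in>A. x \<sqsubseteq>\<^bsub>Q\<^esub> u}"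
  by (auto simp: Upper_def)

context
  fixes f :: "'a \<Rightarrow> 'b" and P :: "'a gorder"
  assumes inj: "inj f" and po: "partial_order P"
begin

lemma transport_simps:
  "carrier (transport f P) = f ` carrier P"
  "f x \<sqsubseteq>\<^bsub>transport f P\<^esub> f y \<longleftrightarrow> x \<sqsubseteq>\<^bsub>P\<^esub> y"
  by (simp_all add: transport_def inv_f_f[OF inj])

lemma partial_order_transport: "partial_order (transport f P)"
proof -
  interpret partial_order P by (rule po)
  show ?thesis
  proof unfold_locales
    fix x y z
    assume c: "x \<in> carrier (transport f P)" "y \<in> carrier (transport f P)" "z \<in> carrier (transport f P)"
    then obtain a b c where abc: "x = f a" "y = f b" "z = f c"
        "a \<in> carrier P" "b \<in> carrier P" "c \<in> carrier P"
      by (auto simp: transport_simps)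
    show "x \<sqsubseteq>\<^bsub>transport f P\<^esub> y \<Longrightarrow> y \<sqsubseteq>\<^bsub>transport f P\<^esub> z \<Longrightarrow> x \<sqsubseteq>\<^bsub>transport f P\<^esub> z"
      using abc by (auto simp: transport_simps intro: le_trans)
  next
    fix x y
    assume "x \<in> carrier (transport f P)" "y \<in> carrier (transport f P)"
    then obtain a b where "x = f a" "y = f b" "a \<in> carrier P" "b \<in> carrier P"
      by (auto simp: transport_simps)
    then show "x \<sqsubseteq>\<^bsub>transport f P\<^esub> y \<Longrightarrow> y \<sqsubseteq>\<^bsub>transport f P\<^esub> x \<Longrightarrow> x .=\<^bsub>transport f P\<^esub> y"
      using le_antisym[of a b] by (auto simp: transport_simps) (simp add: transport_def)
  next
    show "x \<sqsubseteq>\<^bsub>transport f P\<^esub> x" if "x \<in> carrier (transport f P)" for x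
      using that by (auto simp: transport_simps)
  qed (auto simp: transport_def)
qed

lemma transport_subsetE:
  assumes "A \<subseteq> carrier (transport f P)"
  obtains B where "B \<subseteq> carrier P" "A = f ` B"
  using assms by (auto simp: transport_simps subset_image_iff)

lemma directed_transport: "D \<subseteq> carrier P \<Longrightarrow> directed (transport f P) (f ` D) \<longleftrightarrow> directed P D"
  by (auto simp: directed_def transport_simps)

lemma is_lub_transport:
  assumes "A \<subseteq> carrier P" "s \<in> carrier P"
  shows "is_lub (transport f P) (f s) (f ` A) \<longleftrightarrow> is_lub P s A"
proof -
  have "f ` A \<subseteq> carrier (transport f P)" using assms(1) by (auto simp: transport_simps)
  then have "Upper (transport f P) (f ` A) = f ` Upper P A"
    by (auto simp: Upper_eq assms(1) transport_simps)
  then show ?thesis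
    using assms subsetD[OF Upper_closed[of P A]]
    by (auto simp: least_def transport_simps inj_image_mem_iff[OF inj])
qed

lemma bounded_complete_dcpo_transport:
  assumes "bounded_complete_dcpo P"
  shows "bounded_complete_dcpo (transport f P)"
proof -
  interpret bounded_complete_dcpo P by fact
  interpret T: partial_order "transport f P" by (rule partial_order_transport)
  have lub: "\<exists>s. is_lub (transport f P) s (f ` A)" if "A \<subseteq> carrier P" "is_lub P s A" for A s
    using is_lub_transport[of A s] that by (auto simp: least_def Upper_def)
  show ?thesis
  proof unfold_locales
    fix D assume D: "directed (transport f P) D"
    then obtain E where E: "E \<subseteq> carrier P" "D = f ` E"
      using transport_subsetE[of D] by (auto simp: directed_def)
    with D obtain s where "is_lub P s E"
      using directed_has_lub[of E] directed_transport[of E] by auto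
    with E show "\<exists>s. is_lub (transport f P) s D" using lub by auto
  next
    fix A u
    assume A: "A \<subseteq> carrier (transport f P)" "A \<noteq> {}" and u: "u \<in> carrier (transport f P)"
      and le: "\<And>x. x \<in> A \<Longrightarrow> x \<sqsubseteq>\<^bsub>transport f P\<^esub> u"
    obtain B where B: "B \<subseteq> carrier P" "A = f ` B" using transport_subsetE[OF A(1)] .
    obtain v where v: "v \<in> carrier P" "u = f v" using u by (auto simp: transport_simps)
    have "x \<sqsubseteq>\<^bsub>P\<^esub> v" if "x \<in> B" for x
      using le[of "f x"] that B v by (simp add: transport_simps)
    then obtain s where "is_lub P s B"
      using bounded_has_lub[of B v] A(2) B v by auto
    with B show "\<exists>s. is_lub (transport f P) s A" using lub by auto
  qed
qed

lemma scott_open_transport: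
  assumes "U \<subseteq> carrier P"
  shows "scott_open (transport f P) (f ` U) \<longleftrightarrow> scott_open P U"
proof
  assume U: "scott_open (transport f P) (f ` U)"
  show "scott_open P U"
    unfolding scott_open_def
  proof (intro conjI ballI allI impI assms)
    fix x y assume "x \<in> U" "y \<in> carrier P" "x \<sqsubseteq>\<^bsub>P\<^esub> y"
    then have "f y \<in> f ` U"
      using U unfolding scott_open_def by (auto simp: transport_simps)
    then show "y \<in> U" by (simp add: inj_image_mem_iff[OF inj])
  next
    fix D s assume D: "directed P D \<and> is_lub P s D \<and> s \<in> U"
    then have "D \<subseteq> carrier P" by (simp add: directed_def)
    then have "f ` D \<inter> f ` U \<noteq> {}"
      using U D assms directed_transport[of D] is_lub_transport[of D s]
      unfolding scott_open_def by blast
    then show "D \<inter> U \<noteq> {}"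
      using image_Int[OF inj, of D U] by auto
  qed
next
  assume U: "scott_open P U"
  show "scott_open (transport f P) (f ` U)"
    unfolding scott_open_def
  proof (intro conjI ballI allI impI)
    show "f ` U \<subseteq> carrier (transport f P)" using assms by (auto simp: transport_simps)
  next
    fix x y assume "x \<in> f ` U" "y \<in> carrier (transport f P)" "x \<sqsubseteq>\<^bsub>transport f P\<^esub> y"
    then show "y \<in> f ` U"
      using U unfolding scott_open_def by (auto simp: transport_simps)
  next
    fix D s assume D: "directed (transport f P) D \<and> is_lub (transport f P) s D \<and> s \<in> f ` U"
    then obtain E where E: "E \<subseteq> carrier P" "D = f ` E"
      using transport_subsetE[of D] by (auto simp: directed_def)
    obtain t where t: "t \<in> U" "s = f t" using D by blast
    then have "is_lub P t E" "directed P E"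
      using D E assms is_lub_transport[of E t] directed_transport[of E] by auto
    then have "E \<inter> U \<noteq> {}" using U t unfolding scott_open_def by blast
    then show "D \<inter> f ` U \<noteq> {}" using E by blast
  qed
qed

lemma Max_elements_transport: "Max_elements (transport f P) = f ` Max_elements P"
  by (auto simp: Max_elements_def transport_simps inj_eq[OF inj])

end

lemma homeomorphic_spaceI_scott:
  fixes h :: "'c \<Rightarrow> 'a"
  assumes inj: "inj h" and range: "range h = Max_elements P"
    and openin: "\<And>U. (\<exists>V. scott_open P V \<and> V \<inter> Max_elements P = h ` U) \<longleftrightarrow> openin X U"
    and X: "topspace X = UNIV"
  shows "subtopology (scott_topology P) (Max_elements P) homeomorphic_space X"
proof -
  let ?M = "subtopology (scott_topology P) (Max_elements P)"
  have M: "Max_elements P \<subseteq> carrier P" by (auto simp: Max_elements_def)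
  have top: "topspace ?M = range h" using M range by auto
  have openM: "openin ?M (h ` U) \<longleftrightarrow> openin X U" for U
    using openin[of U] unfolding openin_subtopology by auto
  have "homeomorphic_map X ?M h"
  proof (rule bijective_open_imp_homeomorphic_map)
    show "continuous_map X ?M h"
      unfolding continuous_map_def
    proof (intro conjI allI impI)
      show "h \<in> topspace X \<rightarrow> topspace ?M" using top by auto
      fix W assume W: "openin ?M W"
      then have "W \<subseteq> range h" using openin_subset top by metis
      then have "h ` {x. h x \<in> W} = W" by auto
      then show "openin X {x \<in> topspace X. h x \<in> W}"
        using W openM[of "{x. h x \<in> W}"] X by simp
    qed
    show "open_map X ?M h"
      unfolding open_map_def using openM by blast
    show "h ` topspace X = topspace ?M" using top X by simp
    show "inj_on h (topspace X)" using inj X by simp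
  qed
  then show ?thesis
    using homeomorphic_map_imp_homeomorphic_space homeomorphic_space_sym by blast
qed

section \<open>Limits of increasing sequences\<close>

definition lub :: "'a::wellorder set \<Rightarrow> 'a" where
  "lub A = (LEAST u. \<forall>y\<in>A. y \<le> u)"

definition slub :: "'a::wellorder set \<Rightarrow> 'a" where
  "slub A = (LEAST u. \<forall>y\<in>A. y < u)"

lemma lub_upper: "bdd_above A \<Longrightarrow> y \<in> A \<Longrightarrow> y \<le> lub A"
  unfolding lub_def bdd_above_def using LeastI_ex[of "\<lambda>u. \<forall>y\<in>A. y \<le> u"] by blast

lemma lub_least: "(\<And>y. y \<in> A \<Longrightarrow> y \<le> u) \<Longrightarrow> lub A \<le> u"
  unfolding lub_def by (rule Least_le) blast

lemma less_lub_iff: "bdd_above A \<Longrightarrow> u < lub A \<longleftrightarrow> (\<exists>y\<in>A. u < y)"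
  using lub_least[of A u] lub_upper[of A] by (meson less_le_trans linorder_not_less)

lemma slub_least: "(\<And>y. y \<in> A \<Longrightarrow> y < u) \<Longrightarrow> slub A \<le> u"
  unfolding slub_def by (rule Least_le) blast

lemma less_slub: "countable A \<Longrightarrow> y \<in> A \<Longrightarrow> y < slub (A :: omega1 set)"
  unfolding slub_def using LeastI_ex[of "\<lambda>u. \<forall>y\<in>A. y < u"] countable_strict_bound_omega1[of A] by blast

lemma bdd_above_countable_omega1: "countable A \<Longrightarrow> bdd_above (A :: omega1 set)"
  using countable_strict_bound_omega1[of A] by (auto simp: bdd_above_def intro: less_imp_le)

lemma slub_mono: "countable B \<Longrightarrow> A \<subseteq> B \<Longrightarrow> slub A \<le> slub (B :: omega1 set)"
  by (rule slub_least) (auto intro: less_slub)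

lemma infinite_nat_ge: "infinite (N :: nat set) \<Longrightarrow> \<exists>n\<in>N. m \<le> n"
  by (meson infinite_nat_iff_unbounded_le)

lemma lub_mono_infinite:
  fixes f :: "nat \<Rightarrow> 'a::wellorder"
  assumes "mono f" "infinite N"
  shows "lub (f ` N) = lub (range f)"
proof -
  have "(\<forall>y\<in>f ` N. y \<le> u) \<longleftrightarrow> (\<forall>y\<in>range f. y \<le> u)" for u
  proof
    assume u: "\<forall>y\<in>f ` N. y \<le> u"
    have "f m \<le> u" for m
    proof -
      obtain n where "n \<in> N" "m \<le> n" using infinite_nat_ge[OF assms(2)] by blast
      then show ?thesis using u monoD[OF assms(1)] order_trans by blast
    qed
    then show "\<forall>y\<in>range f. y \<le> u" by blast
  qed auto
  then show ?thesis by (simp add: lub_def)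
qed

type_synonym point = "wreal \<times> omega1 \<times> nat"

text \<open>The two kinds of limits lead to different levels and classes: limits along a constant level
  climb to the next level, limits along increasing levels climb to the next class.\<close>

definition limit_const :: "point set \<Rightarrow> point \<Rightarrow> bool" where
  "limit_const s x \<longleftrightarrow> (\<exists>\<mu> i k. strict_mono \<mu> \<and> bdd_above (range \<mu>) \<and>
     s = range (\<lambda>n::nat. (\<mu> n, i, k)) \<and> x = (lub (range \<mu>), slub {i}, 0))"

definition limit_incr :: "point set \<Rightarrow> point \<Rightarrow> bool" where
  "limit_incr s x \<longleftrightarrow> (\<exists>\<mu> \<iota> k. mono \<mu> \<and> bdd_above (range \<mu>) \<and> strict_mono \<iota> \<and>
     s = range (\<lambda>n::nat. (\<mu> n, \<iota> n, k)) \<and> x = (lub (range \<mu>), lub (range \<iota>), Suc k))"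

definition limit :: "point set \<Rightarrow> point \<Rightarrow> bool" where
  "limit s x \<longleftrightarrow> limit_const s x \<or> limit_incr s x"

definition level :: "point \<Rightarrow> omega1" where
  "level p = fst (snd p)"

text \<open>Reconstructs the limit from an infinite part of its sequence; whether the levels are
  constant tells which kind of limit it is.\<close>

definition target :: "point set \<Rightarrow> point" where
  "target T = (lub (fst ` T),
     if is_singleton (level ` T) then (slub (level ` T), 0)
     else (lub (level ` T), Suc (the_elem ((snd \<circ> snd) ` T))))"

lemma infinite_index_set:
  assumes "T \<subseteq> range p" "infinite T"
  obtains N where "infinite (N :: nat set)" "T = p ` N"
proof
  show T: "T = p ` {n. p n \<in> T}" using assms(1) by blast
  show "infinite {n. p n \<in> T}" using assms(2) T finite_imageI by metis
qed

text \<open>Infinite parts of a monotone sequence have the same supremum, and they have a single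
  level exactly for limits along a constant level. Consequently two limit sequences with infinite
  intersection have the same target.\<close>

lemma limit_target:
  assumes "limit s x" "T \<subseteq> s" "infinite T"
  shows "x = target T"
  using assms(1) unfolding limit_def
proof
  assume "limit_const s x"
  then obtain \<mu> i k where \<mu>: "strict_mono \<mu>" and s: "s = range (\<lambda>n::nat. (\<mu> n, i, k))"
      and x: "x = (lub (range \<mu>), slub {i}, 0)"
    unfolding limit_const_def by blast
  obtain N where N: "infinite N" "T = (\<lambda>n. (\<mu> n, i, k)) ` N"
    using infinite_index_set[OF assms(2)[unfolded s] assms(3)] .
  have "N \<noteq> {}" using N(1) by auto
  then have "level ` T = {i}" using N(2) by (auto simp: level_def image_iff)
  moreover have "fst ` T = \<mu> ` N" using N by force
  ultimately show ?thesis
    using lub_mono_infinite[OF strict_mono_mono[OF \<mu>] N(1)] x by (simp add: target_def)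
next
  assume "limit_incr s x"
  then obtain \<mu> \<iota> k where \<mu>: "mono \<mu>" and \<iota>: "strict_mono \<iota>"
      and s: "s = range (\<lambda>n::nat. (\<mu> n, \<iota> n, k))"
      and x: "x = (lub (range \<mu>), lub (range \<iota>), Suc k)"
    unfolding limit_incr_def by blast
  obtain N where N: "infinite N" "T = (\<lambda>n. (\<mu> n, \<iota> n, k)) ` N"
    using infinite_index_set[OF assms(2)[unfolded s] assms(3)] .
  have lev: "level ` T = \<iota> ` N" using N by (force simp: level_def)
  have "infinite (\<iota> ` N)"
    using N(1) strict_mono_imp_inj_on[OF \<iota>] finite_imageD inj_on_subset by blast
  then have "\<not> is_singleton (\<iota> ` N)" by (auto simp: is_singleton_def)
  moreover have "fst ` T = \<mu> ` N" using N by force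
  moreover have "N \<noteq> {}" using N(1) by auto
  then have "(snd \<circ> snd) ` T = {k}" using N(2) by (auto simp: image_iff)
  ultimately show ?thesis
    using lub_mono_infinite[OF \<mu> N(1)] lub_mono_infinite[OF strict_mono_mono[OF \<iota>] N(1)] x lev
    by (simp add: target_def)
qed

text \<open>For countable \<open>F\<close> this is the rank along \<open>F\<close>, shifted above
  \<open>b\<close>: strictly increasing on \<open>F\<close> with countable ordinals as
  values.\<close>

function hull_rank :: "'a::wellorder set \<Rightarrow> omega1 \<Rightarrow> 'a \<Rightarrow> omega1" where
  "hull_rank F b x = slub (insert b (hull_rank F b ` (F \<inter> {..<x})))"
  by pat_completeness auto
termination
  by (relation "inv_image {(x, y). x < y} (\<lambda>(F, b, x). x)") (auto simp: wf)

declare hull_rank.simps [simp del]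

text \<open>The strict increase of the bounds along the closure of the first coordinates pays for the
  successor level that a limit of constant level creates.\<close>

lemma countable_limit_hull:
  fixes C :: "point set"
  assumes "countable C"
  obtains H \<alpha> where "C \<subseteq> H" "\<And>p. p \<in> H \<Longrightarrow> level p \<le> \<alpha>"
    "\<And>s x. limit s x \<Longrightarrow> infinite (s \<inter> H) \<Longrightarrow> x \<in> H"
proof -
  let ?F = "fst ` C"
  obtain b where b: "\<forall>i\<in>level ` C. i < b"
    using countable_strict_bound_omega1[of "level ` C"] assms by auto
  define g where "g l = slub (insert b (hull_rank ?F b ` (?F \<inter> {..l})))" for l
  define \<alpha> where "\<alpha> = slub (insert b (hull_rank ?F b ` ?F))"
  \<comment> \<open>Members of \<open>?F\<close> and limits of such members; the least element of
    \<open>wreal\<close> belongs to \<open>L\<close> vacuously.\<close>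
  define L where "L = {l. \<forall>m<l. \<exists>c\<in>?F. m < c \<and> c \<le> l}"
  define H where "H = {p. fst p \<in> L \<and> level p \<le> g (fst p)}"
  have cnt: "countable (insert b (hull_rank ?F b ` A))" if "A \<subseteq> ?F" for A
    using countable_subset[OF that] assms by simp
  have g_mono: "g l \<le> g m" if "l \<le> m" for l m
    unfolding g_def using that by (intro slub_mono cnt) auto
  have g_le: "g l \<le> \<alpha>" for l
    unfolding g_def \<alpha>_def by (intro slub_mono cnt) auto
  have g_strict: "g m < g l" if ml: "m < l" "l \<in> L" for m l
  proof -
    obtain c where c: "c \<in> ?F" "m < c" "c \<le> l" using ml unfolding L_def by blast
    have "g m \<le> hull_rank ?F b c"
      unfolding g_def hull_rank.simps[of ?F b c] using c by (intro slub_mono cnt) auto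
    also have "\<dots> < g l"
      unfolding g_def using c by (intro less_slub cnt) auto
    finally show ?thesis .
  qed
  have b_less: "b < g l" for l
    unfolding g_def by (intro less_slub cnt) auto
  show thesis
  proof
    show "C \<subseteq> H"
    proof
      fix p assume p: "p \<in> C"
      then have "fst p \<in> L" by (auto simp: L_def)
      moreover have "level p \<le> g (fst p)"
        using b p less_trans[OF _ b_less] by (simp add: less_imp_le)
      ultimately show "p \<in> H" by (simp add: H_def)
    qed
    show "level p \<le> \<alpha>" if "p \<in> H" for p
      using that g_le[of "fst p"] by (auto simp: H_def intro: order_trans)
    show "x \<in> H" if lim: "limit s x" and inf: "infinite (s \<inter> H)" for s x
    proof -
      have L_lub: "lub (range \<mu>) \<in> L"
        if \<mu>: "mono \<mu>" "bdd_above (range \<mu>)" and N: "infinite N" "\<And>n. n \<in> N \<Longrightarrow> \<mu> n \<in> L"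
        for \<mu> :: "nat \<Rightarrow> wreal" and N
        unfolding L_def
      proof (intro CollectI allI impI)
        fix m assume "m < lub (range \<mu>)"
        then obtain n where n: "m < \<mu> n" using less_lub_iff[OF \<mu>(2)] by auto
        obtain n' where n': "n' \<in> N" "n \<le> n'" using infinite_nat_ge[OF N(1)] by blast
        have "m < \<mu> n'" using n monoD[OF \<mu>(1) n'(2)] by order
        then obtain c where "c \<in> ?F" "m < c" "c \<le> \<mu> n'" using N(2)[OF n'(1)] unfolding L_def by blast
        moreover have "\<mu> n' \<le> lub (range \<mu>)" by (rule lub_upper[OF \<mu>(2)]) simp
        ultimately show "\<exists>c\<in>?F. m < c \<and> c \<le> lub (range \<mu>)" using order_trans by blast
      qed
      from lim show ?thesis
        unfolding limit_def
      proof
        assume "limit_const s x"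
        then obtain \<mu> i k where \<mu>: "strict_mono \<mu>" "bdd_above (range \<mu>)"
            and s: "s = range (\<lambda>n::nat. (\<mu> n, i, k))" and x: "x = (lub (range \<mu>), slub {i}, 0)"
          unfolding limit_const_def by blast
        obtain N where N: "infinite N" "s \<inter> H = (\<lambda>n. (\<mu> n, i, k)) ` N"
          using infinite_index_set[OF Int_lower1[of s H, unfolded s] inf[unfolded s]] s by metis
        have NH: "\<mu> n \<in> L" "i \<le> g (\<mu> n)" if "n \<in> N" for n
        proof -
          have "(\<mu> n, i, k) \<in> H" using that N(2) by blast
          then show "\<mu> n \<in> L" "i \<le> g (\<mu> n)" by (simp_all add: H_def level_def)
        qed
        let ?l = "lub (range \<mu>)"
        have l: "?l \<in> L" using L_lub[OF strict_mono_mono[OF \<mu>(1)] \<mu>(2) N(1)] NH by blast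
        obtain n where n: "n \<in> N" using N(1) infinite_nat_ge by blast
        have "\<mu> n < \<mu> (Suc n)" using strict_monoD[OF \<mu>(1)] by simp
        also have "\<dots> \<le> ?l" by (rule lub_upper[OF \<mu>(2)]) simp
        finally have "g (\<mu> n) < g ?l" by (rule g_strict[OF _ l])
        with NH(2)[OF n] have "i < g ?l" by (rule le_less_trans)
        then have "slub {i} \<le> g ?l" by (intro slub_least) simp
        then show "x \<in> H" using l x by (simp add: H_def level_def)
      next
        assume "limit_incr s x"
        then obtain \<mu> \<iota> k where \<mu>: "mono \<mu>" "bdd_above (range \<mu>)" and \<iota>: "strict_mono \<iota>"
            and s: "s = range (\<lambda>n::nat. (\<mu> n, \<iota> n, k))"
            and x: "x = (lub (range \<mu>), lub (range \<iota>), Suc k)"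
          unfolding limit_incr_def by blast
        obtain N where N: "infinite N" "s \<inter> H = (\<lambda>n. (\<mu> n, \<iota> n, k)) ` N"
          using infinite_index_set[OF Int_lower1[of s H, unfolded s] inf[unfolded s]] s by metis
        have NH: "\<mu> n \<in> L" "\<iota> n \<le> g (\<mu> n)" if "n \<in> N" for n
        proof -
          have "(\<mu> n, \<iota> n, k) \<in> H" using that N(2) by blast
          then show "\<mu> n \<in> L" "\<iota> n \<le> g (\<mu> n)" by (simp_all add: H_def level_def)
        qed
        let ?l = "lub (range \<mu>)"
        have l: "?l \<in> L" using L_lub[OF \<mu> N(1)] NH by blast
        have "\<iota> n \<le> g ?l" for n
        proof -
          obtain n' where n': "n' \<in> N" "n \<le> n'" using infinite_nat_ge[OF N(1)] by blast
          have "\<iota> n \<le> \<iota> n'" using monoD[OF strict_mono_mono[OF \<iota>] n'(2)] .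
          also have "\<dots> \<le> g (\<mu> n')" by (rule NH(2)[OF n'(1)])
          also have "\<dots> \<le> g ?l" by (rule g_mono, rule lub_upper[OF \<mu>(2)]) simp
          finally show ?thesis .
        qed
        then have "lub (range \<iota>) \<le> g ?l" by (intro lub_least) auto
        then show "x \<in> H" using l x by (simp add: H_def level_def)
      qed
    qed
  qed
qed

section \<open>Limit-closed sets and chains below countably directed sets\<close>

definition limit_closed :: "point set \<Rightarrow> bool" where
  "limit_closed H \<longleftrightarrow> (\<forall>s x. limit s x \<longrightarrow> s \<subseteq> H \<longrightarrow> x \<in> H)"

lemma limit_closed_const:
  fixes \<mu> :: "nat \<Rightarrow> wreal"
  assumes "limit_closed H" "strict_mono \<mu>" "bdd_above (range \<mu>)" "\<And>n. (\<mu> n, i, k) \<in> H"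
  shows "(lub (range \<mu>), slub {i}, 0) \<in> H"
proof -
  have "limit (range (\<lambda>n. (\<mu> n, i, k))) (lub (range \<mu>), slub {i}, 0)"
    unfolding limit_def limit_const_def using assms(2,3)
    by (intro disjI1 exI[of _ \<mu>] exI[of _ i] exI[of _ k]) simp
  then show ?thesis using assms(1,4) unfolding limit_closed_def by blast
qed

lemma limit_closed_incr:
  fixes \<mu> :: "nat \<Rightarrow> wreal"
  assumes "limit_closed H" "mono \<mu>" "bdd_above (range \<mu>)" "strict_mono \<iota>" "\<And>n. (\<mu> n, \<iota> n, k) \<in> H"
  shows "(lub (range \<mu>), lub (range \<iota>), Suc k) \<in> H"
proof -
  have "limit (range (\<lambda>n. (\<mu> n, \<iota> n, k))) (lub (range \<mu>), lub (range \<iota>), Suc k)"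
    unfolding limit_def limit_incr_def using assms(2-4)
    by (intro disjI2 exI[of _ \<mu>] exI[of _ \<iota>] exI[of _ k]) simp
  then show ?thesis using assms(1,5) unfolding limit_closed_def by blast
qed

text \<open>\<open>G\<close> may lie outside \<open>Z\<close>; its elements are sandwiched between
  elements of \<open>Z\<close>, so that the set of limits of chains from \<open>G\<close> can be
  cofinal in the same sense and the construction iterates.\<close>

definition cofinal_in :: "('q \<Rightarrow> 'q \<Rightarrow> bool) \<Rightarrow> 'q set \<Rightarrow> 'q set \<Rightarrow> bool" where
  "cofinal_in R Z G \<longleftrightarrow> (\<forall>z\<in>Z. \<exists>g\<in>G. R z g \<and> (\<exists>z'\<in>Z. R g z'))"

definition countably_directed :: "('q \<Rightarrow> 'q \<Rightarrow> bool) \<Rightarrow> 'q set \<Rightarrow> bool" where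
  "countably_directed R Z \<longleftrightarrow> (\<forall>Y\<subseteq>Z. countable Y \<longrightarrow> (\<exists>z\<in>Z. \<forall>y\<in>Y. R y z))"

lemma countably_directedD: "countably_directed R Z \<Longrightarrow> z \<in> Z \<Longrightarrow> \<exists>z'\<in>Z. R z z'"
  unfolding countably_directed_def by (elim allE[of _ "{z}"]) simp

lemma countably_directed_cofinal: "countably_directed R Z \<Longrightarrow> cofinal_in R Z Z"
  unfolding cofinal_in_def using countably_directedD by metis

text \<open>Elements of \<open>Z\<close> and of the sets \<open>G n\<close> are chosen alternately,
  and countable directedness bounds the chain by a member of \<open>Z\<close>. Letting
  \<open>G n\<close> depend on \<open>n\<close> allows one chain to visit different sets.\<close>

lemma cofinal_chain:
  assumes R: "transp R" and Z: "countably_directed R Z" and G: "\<And>n. cofinal_in R Z (G n)" and z: "z \<in> Z"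
  obtains h z' where "\<And>n::nat. h n \<in> G n" "R z (h 0)" "\<And>n. R (h n) (h (Suc n))" "z' \<in> Z" "\<And>n. R (h n) z'"
proof -
  have "\<forall>n. \<forall>z\<in>Z. \<exists>g z'. g \<in> G n \<and> R z g \<and> z' \<in> Z \<and> R g z'"
    using G unfolding cofinal_in_def by blast
  then obtain g w where gw: "\<And>n z. z \<in> Z \<Longrightarrow> g n z \<in> G n \<and> R z (g n z) \<and> w n z \<in> Z \<and> R (g n z) (w n z)"
    by metis
  define zz where "zz = rec_nat z w"
  have zz_simps: "zz 0 = z" "zz (Suc n) = w n (zz n)" for n by (simp_all add: zz_def)
  have zzZ: "zz n \<in> Z" for n
    by (induction n) (use z gw in \<open>auto simp: zz_simps\<close>)
  let ?h = "\<lambda>n. g n (zz n)"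
  have up: "R (?h n) (zz (Suc n))" and down: "R (zz n) (?h n)" for n
    using gw[OF zzZ[of n]] by (simp_all add: zz_simps)
  obtain z' where z': "z' \<in> Z" "\<And>n. R (zz n) z'"
    using Z[unfolded countably_directed_def, rule_format, of "range zz"] zzZ by auto
  show thesis
  proof (rule that[of ?h z'])
    show "?h n \<in> G n" for n using gw[OF zzZ] by blast
    show "R z (?h 0)" using down[of 0] by (simp add: zz_simps)
    show "R (?h n) (?h (Suc n))" for n using transpD[OF R up down] .
    show "R (?h n) z'" for n using transpD[OF R up z'(2)] .
  qed (rule z'(1))
qed

text \<open>Weak in the first coordinate, so that points on one vertical line are comparable; strict
  in the level, as limits along increasing levels demand.\<close>

definition prec :: "wreal \<times> omega1 \<Rightarrow> wreal \<times> omega1 \<Rightarrow> bool" where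
  "prec p q \<longleftrightarrow> fst p \<le> fst q \<and> snd p < snd q"

lemma transp_prec: "transp prec"
  by (auto simp: transp_def prec_def)

definition tag :: "nat \<Rightarrow> wreal \<times> omega1 \<Rightarrow> point" where
  "tag k p = (fst p, snd p, k)"

text \<open>Limits of chains in one class lie in the next, so by induction every class from
  \<open>k\<close> on is cofinal in \<open>Z\<close>. A chain that visits each of these classes
  infinitely often then has a single limit position, which is occupied in every class beyond
  \<open>k\<close>.\<close>

lemma directed_full:
  assumes H: "limit_closed H" and Z: "countably_directed prec Z" and ZH: "\<And>z. z \<in> Z \<Longrightarrow> tag k z \<in> H"
  shows "\<exists>l i. j \<le> i \<and> (\<forall>m>k. (l, i, m) \<in> H)"
proof -
  \<comment> \<open>Only the members of the chain with index in \<open>N\<close> need class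
    \<open>m\<close>: this subsequence has the same suprema as the chain.\<close>
  have limit_step:
    "tag (Suc m) (lub (range (fst \<circ> h)), lub (range (snd \<circ> h))) \<in> H"
    if h: "\<And>n. prec (h n) (h (Suc n))" "\<And>n. prec (h n) z'" and N: "infinite N" "\<And>n. n \<in> N \<Longrightarrow> tag m (h n) \<in> H"
    for h :: "nat \<Rightarrow> wreal \<times> omega1" and z' N m
  proof -
    obtain r :: "nat \<Rightarrow> nat" where r: "strict_mono r" "\<And>n. r n \<in> N"
      using infinite_enumerate[OF N(1)] by blast
    have mono: "mono (fst \<circ> h)" and smono: "strict_mono (snd \<circ> h)"
      using h(1) by (auto simp: mono_iff_le_Suc strict_mono_Suc_iff prec_def)
    have "bdd_above (range (fst \<circ> h \<circ> r))"
      using h(2) by (auto simp: bdd_above_def prec_def)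
    moreover have "mono (fst \<circ> h \<circ> r)" "strict_mono (snd \<circ> h \<circ> r)"
      using mono smono r(1) strict_mono_mono[OF r(1)] by (auto simp: mono_def strict_mono_def)
    moreover have "((fst \<circ> h \<circ> r) n, (snd \<circ> h \<circ> r) n, m) \<in> H" for n
      using N(2)[OF r(2)[of n]] by (simp add: tag_def)
    ultimately have "(lub (range (fst \<circ> h \<circ> r)), lub (range (snd \<circ> h \<circ> r)), Suc m) \<in> H"
      using limit_closed_incr[OF H] by blast
    moreover have "infinite (range r)"
      using r(1) by (simp add: range_inj_infinite strict_mono_imp_inj_on)
    then have "lub (range (fst \<circ> h \<circ> r)) = lub (range (fst \<circ> h))"
        "lub (range (snd \<circ> h \<circ> r)) = lub (range (snd \<circ> h))"
      using lub_mono_infinite[OF mono, of "range r"] lub_mono_infinite[OF strict_mono_mono[OF smono], of "range r"]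
      by (simp_all add: image_comp)
    ultimately show ?thesis by (simp add: tag_def)
  qed
  have bounds: "prec z (lub (range (fst \<circ> h)), lub (range (snd \<circ> h)))"
      "\<exists>z''\<in>Z. prec (lub (range (fst \<circ> h)), lub (range (snd \<circ> h))) z''"
    if h: "prec z (h 0)" "\<And>n. prec (h n) z'" "z' \<in> Z"
    for z z' and h :: "nat \<Rightarrow> wreal \<times> omega1"
  proof -
    have bdd: "bdd_above (range (fst \<circ> h))" "bdd_above (range (snd \<circ> h))"
      using h(2) by (auto simp: bdd_above_def prec_def intro: less_imp_le)
    have "fst (h 0) \<le> lub (range (fst \<circ> h))" "snd (h 0) \<le> lub (range (snd \<circ> h))"
      using lub_upper[OF bdd(1), of "fst (h 0)"] lub_upper[OF bdd(2), of "snd (h 0)"] by force+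
    then show "prec z (lub (range (fst \<circ> h)), lub (range (snd \<circ> h)))"
      using h(1) by (auto simp: prec_def)
    obtain z'' where z'': "z'' \<in> Z" "prec z' z''" using countably_directedD[OF Z h(3)] by blast
    have "lub (range (fst \<circ> h)) \<le> fst z'" "lub (range (snd \<circ> h)) \<le> snd z'"
      using h(2) by (auto intro!: lub_least simp: prec_def intro: less_imp_le)
    then show "\<exists>z''\<in>Z. prec (lub (range (fst \<circ> h)), lub (range (snd \<circ> h))) z''"
      using z'' by (intro bexI[of _ z'']) (auto simp: prec_def)
  qed
  have cof: "cofinal_in prec Z {p. tag (k + m) p \<in> H}" for m
  proof (induction m)
    case 0
    then show ?case
      using countably_directed_cofinal[OF Z] ZH unfolding cofinal_in_def by fastforce
  next
    case (Suc m)
    show ?case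
      unfolding cofinal_in_def
    proof
      fix z assume "z \<in> Z"
      from cofinal_chain[OF transp_prec Z Suc this] obtain h z' where
        h: "\<And>n::nat. h n \<in> {p. tag (k + m) p \<in> H}" "prec z (h 0)" "\<And>n. prec (h n) (h (Suc n))"
          "z' \<in> Z" "\<And>n. prec (h n) z'" by metis
      have "tag (Suc (k + m)) (lub (range (fst \<circ> h)), lub (range (snd \<circ> h))) \<in> H"
        by (rule limit_step[of h z' UNIV]) (use h in auto)
      then show "\<exists>g\<in>{p. tag (k + Suc m) p \<in> H}. prec z g \<and> (\<exists>z'\<in>Z. prec g z')"
        using bounds[of z h z', OF h(2,5,4)] by (intro bexI[of _ "(lub (range (fst \<circ> h)), lub (range (snd \<circ> h)))"]) auto
    qed
  qed
  \<comment> \<open>Were all levels below \<open>j\<close>, countably many elements of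
    \<open>Z\<close> would realise all of them, and a strict upper bound of these in
    \<open>Z\<close> would have a level of its own.\<close>
  obtain z where z: "z \<in> Z" "j \<le> snd z"
  proof (rule ccontr)
    assume "\<not> thesis"
    then have less: "snd z < j" if "z \<in> Z" for z using that \<open>\<And>z. z \<in> Z \<Longrightarrow> j \<le> snd z \<Longrightarrow> thesis\<close> not_less by blast
    have "countable (snd ` Z)"
      by (rule countable_subset[OF _ countable_atMost_omega1[of j]]) (use less in \<open>auto intro: less_imp_le\<close>)
    then obtain Y where Y: "countable Y" "Y \<subseteq> Z" "snd ` Z = snd ` Y"
      using countable_image_eq_inj[of snd Z] by metis
    obtain z where "z \<in> Z" "\<forall>y\<in>Y. prec y z" using Z Y unfolding countably_directed_def by blast
    moreover then have "snd z \<in> snd ` Y" using Y by blast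
    ultimately show False by (auto simp: prec_def)
  qed
  \<comment> \<open>The first component of \<open>prod_decode\<close> takes every value infinitely
    often, so the chain returns to every class.\<close>
  from cofinal_chain[OF transp_prec Z cof z(1), of "\<lambda>n. fst (prod_decode n)"] obtain h z' where
    h: "\<And>n::nat. h n \<in> {p. tag (k + fst (prod_decode n)) p \<in> H}" "prec z (h 0)" "\<And>n. prec (h n) (h (Suc n))"
      "z' \<in> Z" "\<And>n. prec (h n) z'" by metis
  let ?p = "(lub (range (fst \<circ> h)), lub (range (snd \<circ> h)))"
  have "(fst ?p, snd ?p, m) \<in> H" if km: "k < m" for m
  proof -
    obtain m' where m: "m = Suc (k + m')" using km by (auto simp: less_iff_Suc_add)
    have "inj (\<lambda>n. prod_encode (m', n))" by (auto simp: inj_on_def)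
    then have "infinite (range (\<lambda>n. prod_encode (m', n)))" by (rule range_inj_infinite)
    then have "tag (Suc (k + m')) ?p \<in> H"
      by (rule limit_step[of h z', OF h(3,5)]) (use h(1)[of "prod_encode (m', n)" for n] in auto)
    then show ?thesis by (simp add: m tag_def)
  qed
  moreover have "j \<le> snd ?p"
    using bounds(1)[of z h z', OF h(2,5,4)] z(2) by (auto simp: prec_def)
  ultimately show ?thesis by blast
qed

section \<open>Limit closures of uncountable sets\<close>

lemma less_slub_single: "i < slub {i :: omega1}"
  by (rule less_slub) auto

lemma slub_single_le: "i < j \<Longrightarrow> slub {i} \<le> (j :: omega1)"
  by (rule slub_least) simp

text \<open>The approximating levels are successors because these are reached in class 0, and a
  limit along increasing levels requires one class throughout.\<close>

lemma successors_to_limit: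
  fixes i0 i :: omega1
  assumes "i0 < i" and lim: "\<And>j. j < i \<Longrightarrow> slub {j} < i"
  obtains j :: "nat \<Rightarrow> omega1" where "\<And>n. i0 \<le> j n" "\<And>n. j n < i"
    "strict_mono (\<lambda>n. slub {j n})" "lub (range (\<lambda>n. slub {j n})) = i"
proof -
  have "countable {..<i}"
    by (rule countable_subset[OF _ countable_atMost_omega1[of i]]) auto
  moreover have "{..<i} \<noteq> {}" using assms(1) by auto
  ultimately obtain e :: "nat \<Rightarrow> omega1" where e: "range e = {..<i}"
    using range_from_nat_into by metis
  have e_less: "e n < i" for n using e by auto
  define j where "j = rec_nat i0 (\<lambda>n x. max (slub {x}) (e n))"
  have j_simps: "j 0 = i0" "j (Suc n) = max (slub {j n}) (e n)" for n by (simp_all add: j_def)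
  have j_less: "j n < i" for n
    by (induction n) (use assms(1) lim e_less in \<open>auto simp: j_simps\<close>)
  have Suc: "slub {j n} \<le> j (Suc n)" for n by (simp add: j_simps)
  have step: "slub {j n} < slub {j (Suc n)}" for n
    using Suc less_slub_single by (rule le_less_trans)
  have ge: "i0 \<le> j n" for n
  proof (induction n)
    case (Suc n)
    have "i0 < slub {j n}" using Suc less_slub_single by (rule le_less_trans)
    then show ?case by (simp add: j_simps le_max_iff_disj less_imp_le)
  qed (simp add: j_simps)
  have bdd: "bdd_above (range (\<lambda>n. slub {j n}))"
    by (rule bdd_above_countable_omega1) simp
  have "lub (range (\<lambda>n. slub {j n})) = i"
  proof (rule order_antisym)
    show "lub (range (\<lambda>n. slub {j n})) \<le> i"
      by (rule lub_least) (use lim j_less in \<open>auto intro: less_imp_le\<close>)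
    show "i \<le> lub (range (\<lambda>n. slub {j n}))" (is "i \<le> ?u")
    proof (rule ccontr)
      assume "\<not> i \<le> ?u"
      then have "?u \<in> range e" using e by simp
      then obtain n where "?u = e n" by blast
      then have "?u \<le> j (Suc n)" by (simp add: j_simps)
      also have "\<dots> < slub {j (Suc n)}" by (rule less_slub_single)
      also have "\<dots> \<le> ?u" by (rule lub_upper[OF bdd]) blast
      finally show False by simp
    qed
  qed
  then show thesis
    using that[of j] ge j_less step by (simp add: strict_mono_Suc_iff)
qed

lemma chain_lub_between:
  fixes h :: "nat \<Rightarrow> wreal"
  assumes Z: "countably_directed (<) Z" and h: "z < h 0" "\<And>n. h n < h (Suc n)" "\<And>n. h n < z'" "z' \<in> Z"
  shows "strict_mono h" "bdd_above (range h)" "z < lub (range h)" "\<exists>z''\<in>Z. lub (range h) < z''"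
proof -
  show "strict_mono h" using h(2) by (simp add: strict_mono_Suc_iff)
  show bdd: "bdd_above (range h)" using h(3) by (auto simp: bdd_above_def intro: less_imp_le)
  show "z < lub (range h)" using h(1) less_lub_iff[OF bdd] by auto
  have "lub (range h) \<le> z'" using h(3) by (auto intro!: lub_least intro: less_imp_le)
  then show "\<exists>z''\<in>Z. lub (range h) < z''"
    using countably_directedD[OF Z h(4)] le_less_trans by blast
qed

text \<open>All the levels are reached inside one and the same cut of the first coordinate, given by \<open>Z\<close>;
  otherwise the levels could not be combined at limit stages.\<close>

lemma level_cofinal:
  assumes H: "limit_closed H" and Z: "countably_directed (<) Z" and ZH: "\<And>z. z \<in> Z \<Longrightarrow> (z, i0, k) \<in> H"
    and "i0 \<le> i"
  shows "cofinal_in (<) Z {\<mu>. (\<mu>, slub {i}, 0) \<in> H}"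
proof -
  have succ: "cofinal_in (<) Z {\<mu>. (\<mu>, slub {i}, 0) \<in> H}"
    if cof: "cofinal_in (<) Z {\<mu>. (\<mu>, i, k) \<in> H}" for i k
    unfolding cofinal_in_def
  proof
    fix z assume "z \<in> Z"
    from cofinal_chain[OF transp_on_less Z cof this] obtain h z' where
      h: "\<And>n::nat. h n \<in> {\<mu>. (\<mu>, i, k) \<in> H}" "z < h 0" "\<And>n. h n < h (Suc n)" "z' \<in> Z" "\<And>n. h n < z'"
      by metis
    note lubs = chain_lub_between[of Z z h z', OF Z h(2,3,5,4)]
    have "(lub (range h), slub {i}, 0) \<in> H"
      by (rule limit_closed_const[OF H lubs(1,2)]) (use h(1) in blast)
    then show "\<exists>g\<in>{\<mu>. (\<mu>, slub {i}, 0) \<in> H}. z < g \<and> (\<exists>z'\<in>Z. g < z')"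
      using lubs(3,4) by blast
  qed
  \<comment> \<open>The class depends on the stage: \<open>k\<close> at \<open>i0\<close>, 0 at
    successors, 1 at limits. The final successor step makes it 0 in every case.\<close>
  have "\<exists>k. cofinal_in (<) Z {\<mu>. (\<mu>, i, k) \<in> H}" if "i0 \<le> i" for i
    using that
  proof (induction i rule: less_induct)
    case (less i)
    then consider "i = i0" | "i0 < i" "\<exists>j<i. i \<le> slub {j}" | "i0 < i" "\<And>j. j < i \<Longrightarrow> slub {j} < i"
      by (metis le_less not_le)
    then show ?case
    proof cases
      case 1
      then have "cofinal_in (<) Z {\<mu>. (\<mu>, i, k) \<in> H}"
        using countably_directed_cofinal[OF Z] ZH unfolding cofinal_in_def by blast
      then show ?thesis by blast
    next
      case 2
      then obtain j where j: "j < i" "i \<le> slub {j}" by blast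
      then have i: "i = slub {j}" using slub_single_le[OF j(1)] by simp
      have "i0 \<le> j" using 2(1) i slub_single_le[of j i0] by (meson not_le leD)
      then show ?thesis using less.IH[OF j(1)] succ i by metis
    next
      case 3
      obtain j :: "nat \<Rightarrow> omega1" where j: "\<And>n. i0 \<le> j n" "\<And>n. j n < i" "strict_mono (\<lambda>n. slub {j n})"
          "lub (range (\<lambda>n. slub {j n})) = i"
        using successors_to_limit[OF 3] by metis
      define G where "G n = {\<mu>. (\<mu>, slub {j n}, 0) \<in> H}" for n
      have cof: "cofinal_in (<) Z (G n)" for n
        unfolding G_def using less.IH[OF j(2,1)] succ by blast
      have "cofinal_in (<) Z {\<mu>. (\<mu>, i, Suc 0) \<in> H}"
        unfolding cofinal_in_def
      proof
        fix z assume "z \<in> Z"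
        from cofinal_chain[of "(<)" Z G z, OF transp_on_less Z cof this] obtain h z' where
          h: "\<And>n::nat. h n \<in> G n" "z < h 0" "\<And>n. h n < h (Suc n)" "z' \<in> Z" "\<And>n. h n < z'"
          by metis
        note lubs = chain_lub_between[of Z z h z', OF Z h(2,3,5,4)]
        have "(lub (range h), lub (range (\<lambda>n. slub {j n})), Suc 0) \<in> H"
          by (rule limit_closed_incr[OF H strict_mono_mono[OF lubs(1)] lubs(2) j(3)]) (use h(1) in \<open>simp add: G_def\<close>)
        then show "\<exists>g\<in>{\<mu>. (\<mu>, i, Suc 0) \<in> H}. z < g \<and> (\<exists>z'\<in>Z. g < z')"
          using lubs(3,4) j(4) by auto
      qed
      then show ?thesis by blast
    qed
  qed
  then show ?thesis using succ \<open>i0 \<le> i\<close> by blast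
qed

text \<open>Given countably many points of class 0 in \<open>H\<close> to the left of members of
  \<open>Z\<close>, their first coordinates are exceeded by one \<open>z\<close> in \<open>Z\<close>
  and their levels by a countable ordinal. \<open>level_cofinal\<close> supplies a higher point
  beyond \<open>z\<close> that is still to the left of a member of \<open>Z\<close>, so these points
  are countably directed.\<close>

lemma countably_directed_level_full:
  assumes H: "limit_closed H" and Z: "countably_directed (<) Z" and ZH: "\<And>z. z \<in> Z \<Longrightarrow> (z, i0, k) \<in> H"
  shows "\<exists>l i. j \<le> i \<and> (\<forall>m>0. (l, i, m) \<in> H)"
proof (rule directed_full[OF H])
  let ?Y = "{p. tag 0 p \<in> H \<and> (\<exists>z\<in>Z. fst p < z)}"
  show "countably_directed prec ?Y"
    unfolding countably_directed_def
  proof (intro allI impI)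
    fix Y assume Y: "Y \<subseteq> ?Y" "countable Y"
    then have "\<forall>p\<in>Y. \<exists>z. z \<in> Z \<and> fst p < z" by blast
    then obtain f where f: "\<And>p. p \<in> Y \<Longrightarrow> f p \<in> Z \<and> fst p < f p" by metis
    have "f ` Y \<subseteq> Z" "countable (f ` Y)" using f Y(2) by auto
    then obtain z where z: "z \<in> Z" "\<forall>y\<in>f ` Y. y < z"
      using Z unfolding countably_directed_def by blast
    obtain i1 where i1: "\<forall>j\<in>snd ` Y. j < i1"
      using countable_strict_bound_omega1[of "snd ` Y"] Y(2) by auto
    let ?i = "max i0 i1"
    obtain \<mu> z' where \<mu>: "(\<mu>, slub {?i}, 0) \<in> H" "z < \<mu>" "z' \<in> Z" "\<mu> < z'"
      using level_cofinal[OF H Z ZH, of ?i] z(1) unfolding cofinal_in_def by auto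
    have "prec p (\<mu>, slub {?i})" if p: "p \<in> Y" for p
    proof -
      have "fst p < f p" "f p < z" using f[OF p] z(2) p by auto
      then have "fst p < \<mu>" using \<mu>(2) by order
      moreover have "snd p < i1" "i1 \<le> ?i" "?i < slub {?i}"
        using i1 p less_slub_single by auto
      then have "snd p < slub {?i}" by order
      ultimately show ?thesis by (simp add: prec_def)
    qed
    moreover have "(\<mu>, slub {?i}) \<in> ?Y" using \<mu> by (auto simp: tag_def)
    ultimately show "\<exists>z\<in>?Y. \<forall>y\<in>Y. prec y z" by blast
  qed
qed simp

text \<open>The elements with countably many predecessors in \<open>S\<close> behave like the first
  uncountable ordinal, whatever the order type of \<open>S\<close>.\<close>

lemma uncountable_directed_part:
  fixes S :: "'a::wellorder set"
  assumes "uncountable S"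
  shows "\<exists>Z\<subseteq>S. uncountable Z \<and> (\<forall>Y\<subseteq>Z. countable Y \<longrightarrow> countable {x \<in> S. \<exists>y\<in>Y. x \<le> y})"
proof (intro exI conjI allI impI)
  let ?Z = "{z \<in> S. countable (S \<inter> {..z})}"
  show "?Z \<subseteq> S" by blast
  show "uncountable ?Z" by (rule uncountable_initial_part[OF assms])
  fix Y assume Y: "Y \<subseteq> ?Z" "countable Y"
  have "{x \<in> S. \<exists>y\<in>Y. x \<le> y} = (\<Union>y\<in>Y. S \<inter> {..y})" by auto
  moreover have "countable (\<Union>y\<in>Y. S \<inter> {..y})"
    by (rule countable_UN[OF Y(2)]) (use Y(1) in blast)
  ultimately show "countable {x \<in> S. \<exists>y\<in>Y. x \<le> y}" by simp
qed

text \<open>Some class contains uncountably many points of \<open>A\<close>. An uncountable column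
  is directed for \<open>prec\<close> as it stands, an uncountable row first has to climb through
  the levels, and if all rows and columns are countable a directed part is extracted by
  counting.\<close>

lemma uncountable_limit_closure:
  assumes H: "limit_closed H" and A: "A \<subseteq> H" "uncountable A"
  shows "\<exists>l i k. j \<le> i \<and> (\<forall>m>k. (l, i, m) \<in> H)"
proof -
  have sub: "A \<subseteq> (\<Union>k. tag k ` {p. tag k p \<in> A})"
  proof
    fix x assume x: "x \<in> A"
    obtain l i k where "x = (l, i, k)" by (cases x) auto
    then show "x \<in> (\<Union>k. tag k ` {p. tag k p \<in> A})"
      using x by (auto simp: tag_def intro!: exI[of _ k] image_eqI[of _ _ "(l, i)"])
  qed
  have "\<exists>k. uncountable {p. tag k p \<in> A}"
  proof (rule ccontr)
    assume "\<not> ?thesis"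
    then have "countable {p. tag k p \<in> A}" for k by blast
    then have "countable (\<Union>k. tag k ` {p. tag k p \<in> A})" by simp
    then show False using countable_subset[OF sub] A(2) by blast
  qed
  then obtain k where k: "uncountable {p. tag k p \<in> A}" ..
  let ?B = "{p. tag k p \<in> A}"
  have full: ?thesis if "countably_directed prec Z" "Z \<subseteq> ?B" for Z
    using directed_full[OF H that(1), of k j] that(2) A(1) by blast
  consider (column) \<mu> where "uncountable {i. (\<mu>, i) \<in> ?B}"
    | (row) i where "uncountable {\<mu>. (\<mu>, i) \<in> ?B}"
    | (thin) "\<And>\<mu>. countable {i. (\<mu>, i) \<in> ?B}" "\<And>i. countable {\<mu>. (\<mu>, i) \<in> ?B}"
    by blast
  then show ?thesis
  proof cases
    case column
    let ?I = "{i. (\<mu>, i) \<in> ?B}"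
    have "countably_directed prec (Pair \<mu> ` ?I)"
      unfolding countably_directed_def
    proof (intro allI impI)
      fix Y assume Y: "Y \<subseteq> Pair \<mu> ` ?I" "countable Y"
      obtain u where u: "\<forall>i\<in>snd ` Y. i < u"
        using countable_strict_bound_omega1[of "snd ` Y"] Y(2) by auto
      have "\<not> ?I \<subseteq> {..u}"
        by (rule contrapos_nn[OF column]) (rule countable_subset[OF _ countable_atMost_omega1])
      then obtain i where "i \<in> ?I" "\<not> i \<le> u" by blast
      moreover have "prec y (\<mu>, i)" if "y \<in> Y" for y
        using u Y(1) that \<open>\<not> i \<le> u\<close> by (force simp: prec_def not_le)
      ultimately show "\<exists>z\<in>Pair \<mu> ` ?I. \<forall>y\<in>Y. prec y z" by blast
    qed
    then show ?thesis by (rule full) auto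
  next
    case row
    obtain Z where
      Z: "Z \<subseteq> {\<mu>. (\<mu>, i) \<in> ?B}" "uncountable Z"
        "\<forall>Y\<subseteq>Z. countable Y \<longrightarrow> countable {x \<in> {\<mu>. (\<mu>, i) \<in> ?B}. \<exists>y\<in>Y. x \<le> y}"
      using uncountable_directed_part[OF row] by blast
    have "countably_directed (<) Z"
      unfolding countably_directed_def
    proof (intro allI impI)
      fix Y assume Y: "Y \<subseteq> Z" "countable Y"
      have "\<not> Z \<subseteq> {x \<in> {\<mu>. (\<mu>, i) \<in> ?B}. \<exists>y\<in>Y. x \<le> y}"
        by (rule contrapos_nn[OF Z(2)]) (rule countable_subset[OF _ Z(3)[rule_format, OF Y]])
      then obtain z where "z \<in> Z" "\<forall>y\<in>Y. \<not> z \<le> y" using Z(1) by blast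
      then show "\<exists>z\<in>Z. \<forall>y\<in>Y. y < z" by (auto simp: not_le)
    qed
    moreover have "(z, i, k) \<in> H" if "z \<in> Z" for z
      using Z(1) that A(1) by (auto simp: tag_def)
    ultimately show ?thesis
      using countably_directed_level_full[OF H, of Z i k j] by blast
  next
    case thin
    have sub: "C \<subseteq> (\<Union>\<mu>\<in>fst ` C. Pair \<mu> ` {i. (\<mu>, i) \<in> ?B})" if "C \<subseteq> ?B" for C
      using that by force
    have count: "countable C" if C: "C \<subseteq> ?B" "countable (fst ` C)" for C
      by (rule countable_subset[OF sub[OF C(1)]], rule countable_UN[OF C(2)])
        (rule countable_image[OF thin(1)])
    have "uncountable (fst ` ?B)" using count[of ?B] k by blast
    from uncountable_directed_part[OF this] obtain Z where
      Z: "Z \<subseteq> fst ` ?B" "uncountable Z"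
        "\<forall>Y\<subseteq>Z. countable Y \<longrightarrow> countable {x \<in> fst ` ?B. \<exists>y\<in>Y. x \<le> y}"
      by blast
    let ?Z = "{p \<in> ?B. fst p \<in> Z}"
    have img: "fst ` ?Z = Z" using Z(1) by auto
    have "uncountable (fst ` ?Z)" unfolding img by (rule Z(2))
    then have unc: "uncountable ?Z" by (rule contrapos_nn) (rule countable_image)
    have "countably_directed prec ?Z"
      unfolding countably_directed_def
    proof (intro allI impI)
      fix Y assume Y: "Y \<subseteq> ?Z" "countable Y"
      obtain u where u: "\<forall>i\<in>snd ` Y. i < u"
        using countable_strict_bound_omega1[of "snd ` Y"] Y(2) by auto
      \<comment> \<open>\<open>?L\<close> meets countably many columns and \<open>?M\<close>
        countably many rows, each countable; a point of \<open>?Z\<close> outside both is above all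
        of \<open>Y\<close>.\<close>
      let ?L = "{p \<in> ?B. \<exists>y\<in>fst ` Y. fst p \<le> y}" and ?M = "{p \<in> ?B. snd p \<le> u}"
      have "fst ` ?L \<subseteq> {x \<in> fst ` ?B. \<exists>y\<in>fst ` Y. x \<le> y}" by auto
      moreover have "countable {x \<in> fst ` ?B. \<exists>y\<in>fst ` Y. x \<le> y}"
        by (rule Z(3)[rule_format]) (use Y in auto)
      ultimately have "countable (fst ` ?L)" by (rule countable_subset)
      then have L: "countable ?L" by (intro count) auto
      have "?M \<subseteq> (\<Union>i\<in>{..u}. (\<lambda>\<mu>. (\<mu>, i)) ` {\<mu>. (\<mu>, i) \<in> ?B})" by force
      moreover have "countable (\<Union>i\<in>{..u}. (\<lambda>\<mu>. (\<mu>, i)) ` {\<mu>. (\<mu>, i) \<in> ?B})"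
        by (rule countable_UN[OF countable_atMost_omega1], rule countable_image[OF thin(2)])
      ultimately have "countable ?M" by (rule countable_subset)
      with L have LM: "countable (?L \<union> ?M)" by simp
      have "\<not> ?Z \<subseteq> ?L \<union> ?M"
        by (rule contrapos_nn[OF unc]) (rule countable_subset[OF _ LM])
      then obtain p where p: "p \<in> ?Z" "p \<notin> ?L" "p \<notin> ?M" by blast
      have "prec y p" if "y \<in> Y" for y
        using p that u by (force simp: prec_def not_le)
      then show "\<exists>z\<in>?Z. \<forall>y\<in>Y. prec y z" using p(1) by blast
    qed
    then show ?thesis by (rule full) blast
  qed
qed

section \<open>Almost disjoint rules\<close>

text \<open>Zorn's lemma: a \<open>\<tau>\<close> almost disjoint from the whole family could be
  added, hence already belongs to it, and an infinite first component is not almost disjoint from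
  itself.\<close>

lemma maximal_almost_disjoint:
  fixes L :: "('a set \<times> 'b) set"
  shows "\<exists>R\<subseteq>L. pairwise (\<lambda>\<sigma> \<tau>. finite (fst \<sigma> \<inter> fst \<tau>)) R \<and>
           (\<forall>\<tau>\<in>L. infinite (fst \<tau>) \<longrightarrow> (\<exists>\<sigma>\<in>R. infinite (fst \<sigma> \<inter> fst \<tau>)))"
proof -
  let ?ad = "\<lambda>\<sigma> \<tau> :: 'a set \<times> 'b. finite (fst \<sigma> \<inter> fst \<tau>)"
  let ?A = "{R. R \<subseteq> L \<and> pairwise ?ad R}"
  have "\<exists>M\<in>?A. \<forall>X\<in>?A. M \<subseteq> X \<longrightarrow> X = M"
  proof (rule subset_Zorn')
    fix \<C> assume chain: "subset.chain ?A \<C>"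
    have "?ad \<sigma> \<tau>" if \<sigma>\<tau>: "\<sigma> \<in> \<Union>\<C>" "\<tau> \<in> \<Union>\<C>" "\<sigma> \<noteq> \<tau>" for \<sigma> \<tau>
    proof -
      obtain X Y where "X \<in> \<C>" "\<sigma> \<in> X" "Y \<in> \<C>" "\<tau> \<in> Y" using \<sigma>\<tau> by blast
      moreover have "X \<subseteq> Y \<or> Y \<subseteq> X" using chain calculation by (auto simp: subset_chain_def)
      ultimately obtain Z where "Z \<in> \<C>" "\<sigma> \<in> Z" "\<tau> \<in> Z" by blast
      then have "pairwise ?ad Z" using chain by (auto simp: subset_chain_def)
      then show ?thesis using \<open>\<sigma> \<in> Z\<close> \<open>\<tau> \<in> Z\<close> \<sigma>\<tau>(3) by (rule pairwiseD)
    qed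
    then show "\<Union>\<C> \<in> ?A"
      using chain by (auto simp: subset_chain_def pairwise_def)
  qed
  then obtain M where "M \<in> ?A" and max: "\<forall>X\<in>?A. M \<subseteq> X \<longrightarrow> X = M"
    by (rule bexE)
  then have M: "M \<subseteq> L" "pairwise ?ad M" by simp_all
  have "\<exists>\<sigma>\<in>M. infinite (fst \<sigma> \<inter> fst \<tau>)" if \<tau>: "\<tau> \<in> L" "infinite (fst \<tau>)" for \<tau>
  proof (rule ccontr)
    assume neg: "\<not> ?thesis"
    then have "pairwise ?ad (insert \<tau> M)"
      using M(2) by (auto simp: pairwise_insert Int_commute)
    then have "insert \<tau> M \<in> ?A" using M(1) \<tau>(1) by simp
    then have "\<tau> \<in> M" using max by blast
    with neg \<tau>(2) show False by auto
  qed
  with M show ?thesis by blast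
qed

text \<open>Branches of the binary tree: \<open>b x\<close> collects the codes of the initial
  segments of \<open>g x\<close>, and two branches share no code beyond their first
  difference.\<close>

lemma almost_disjoint_nat_sets:
  fixes g :: "'a \<Rightarrow> nat set"
  assumes "inj g"
  obtains b :: "'a \<Rightarrow> nat set" where "\<And>x. infinite (b x)" "\<And>x y. x \<noteq> y \<Longrightarrow> finite (b x \<inter> b y)"
proof
  let ?e = "\<lambda>x n. prod_encode (n, set_encode (g x \<inter> {..<n}))"
  show "infinite (range (?e x))" for x
    by (rule range_inj_infinite) (auto simp: inj_on_def)
  show "finite (range (?e x) \<inter> range (?e y))" if "x \<noteq> y" for x y
  proof -
    have "g x \<noteq> g y" using assms that by (auto dest: injD)
    then obtain k where k: "(k \<in> g x) \<noteq> (k \<in> g y)" by blast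
    have "n \<le> k" if eq: "?e x n = ?e y n'" for n n'
    proof (rule ccontr)
      assume nk: "\<not> n \<le> k"
      have "g x \<inter> {..<n} = g y \<inter> {..<n}"
        using eq set_encode_eq[of "g x \<inter> {..<n}" "g y \<inter> {..<n'}"] by auto
      then have "k \<in> g x \<inter> {..<n} \<longleftrightarrow> k \<in> g y \<inter> {..<n}" by (simp only:)
      then show False using k nk by simp
    qed
    then have "range (?e x) \<inter> range (?e y) \<subseteq> ?e x ` {..k}" by auto
    then show ?thesis by (rule finite_subset) simp
  qed
qed

section \<open>Cardinality of the points and of the carrier\<close>

lemma wreal_lepoll_real: "(UNIV :: wreal set) \<lesssim> (UNIV :: real set)"
  unfolding lepoll_def using Rep_wreal_inject by (auto simp: inj_on_def)

lemma omega1_lepoll_real: "(UNIV :: omega1 set) \<lesssim> (UNIV :: real set)"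
proof -
  have "inj Rep_omega1" by (simp add: inj_on_def Rep_omega1_inject)
  then have "(UNIV :: omega1 set) \<lesssim> (UNIV :: wreal set)" unfolding lepoll_def by blast
  then show ?thesis using wreal_lepoll_real by (rule lepoll_trans)
qed

lemma prod_lepoll_real:
  assumes "(UNIV :: 'a set) \<lesssim> (UNIV :: real set)" "(UNIV :: 'b set) \<lesssim> (UNIV :: real set)"
  shows "(UNIV :: ('a \<times> 'b) set) \<lesssim> (UNIV :: real set)"
proof -
  have "(UNIV :: 'a set) \<times> (UNIV :: 'b set) \<lesssim> (UNIV :: real set) \<times> (UNIV :: real set)"
    using assms by (rule times_lepoll_mono)
  also have "(UNIV :: real set) \<times> (UNIV :: real set) \<lesssim> (UNIV :: real set)"
    unfolding lepoll_def card_of_ordLeq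
    by (rule ordIso_imp_ordLeq[OF card_of_Times_same_infinite]) (rule infinite_UNIV_char_0)
  finally show ?thesis by simp
qed

lemma nat_lepoll_real: "(UNIV :: nat set) \<lesssim> (UNIV :: real set)"
  unfolding lepoll_def by (intro exI[of _ real]) (simp add: inj_on_def)

lemma point_lepoll_real: "(UNIV :: point set) \<lesssim> (UNIV :: real set)"
  by (intro prod_lepoll_real wreal_lepoll_real omega1_lepoll_real nat_lepoll_real)

lemma point_eqpoll_real: "(UNIV :: real set) \<approx> (UNIV :: point set)"
proof -
  have "inj (\<lambda>x. (Abs_wreal x, i, n) :: point)" for i n
    by (simp add: inj_on_def Abs_wreal_inject)
  then have "(UNIV :: real set) \<lesssim> (UNIV :: point set)" unfolding lepoll_def by blast
  then show ?thesis using point_lepoll_real by (rule lepoll_antisym)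
qed

text \<open>A function is coded by its graph, viewed as a set of reals; the two singleton brackets
  only lift it to the required type.\<close>

lemma ex_inj_universe: "\<exists>f :: (point \<Rightarrow> cval) \<Rightarrow> poset_universe. inj f"
proof -
  have "inj (case_option (0 :: nat, undefined) (\<lambda>i :: omega1. (1, i)))"
    by (auto simp: inj_on_def split: option.splits)
  then have "(UNIV :: omega1 option set) \<lesssim> (UNIV :: (nat \<times> omega1) set)"
    unfolding lepoll_def by blast
  also have "\<dots> \<lesssim> (UNIV :: real set)"
    by (intro prod_lepoll_real omega1_lepoll_real nat_lepoll_real)
  finally have "(UNIV :: (point \<times> omega1 option) set) \<lesssim> (UNIV :: real set)"
    by (rule prod_lepoll_real[OF point_lepoll_real])
  then obtain e :: "point \<times> omega1 option \<Rightarrow> real" where e: "inj e"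
    unfolding lepoll_def by blast
  have "inj (\<lambda>\<phi> :: point \<Rightarrow> cval. {{e ` (SIGMA x:UNIV. Rep_cval (\<phi> x))}})"
  proof (rule injI)
    fix \<phi> \<psi> :: "point \<Rightarrow> cval"
    assume "{{e ` (SIGMA x:UNIV. Rep_cval (\<phi> x))}} = {{e ` (SIGMA x:UNIV. Rep_cval (\<psi> x))}}"
    then have eq: "(SIGMA x:UNIV. Rep_cval (\<phi> x)) = (SIGMA x:UNIV. Rep_cval (\<psi> x))"
      by (simp add: inj_image_eq_iff[OF e])
    have "Rep_cval (\<phi> x) = Rep_cval (\<psi> x)" for x
    proof (rule Set.set_eqI)
      show "w \<in> Rep_cval (\<phi> x) \<longleftrightarrow> w \<in> Rep_cval (\<psi> x)" for w
        using eqset_imp_iff[OF eq, of "(x, w)"] by simp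
    qed
    then show "\<phi> = \<psi>" by (simp add: Rep_cval_inject fun_eq_iff)
  qed
  then show ?thesis by blast
qed

section \<open>The concrete rules: countable and uncountable sets of points\<close>

definition limit_family :: "(point set \<times> point) set" where
  "limit_family = (SOME R. R \<subseteq> {(s, x). limit s x} \<and>
     pairwise (\<lambda>\<sigma> \<tau>. finite (fst \<sigma> \<inter> fst \<tau>)) R \<and>
     (\<forall>\<tau>\<in>{(s, x). limit s x}. infinite (fst \<tau>) \<longrightarrow> (\<exists>\<sigma>\<in>R. infinite (fst \<sigma> \<inter> fst \<tau>))))"

lemma limit_family:
  "(s, x) \<in> limit_family \<Longrightarrow> limit s x"
  "pairwise (\<lambda>\<sigma> \<tau>. finite (fst \<sigma> \<inter> fst \<tau>)) limit_family"
  "limit s x \<Longrightarrow> infinite s \<Longrightarrow> \<exists>(t, y)\<in>limit_family. infinite (t \<inter> s)"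
proof -
  have *: "limit_family \<subseteq> {(s, x). limit s x} \<and>
     pairwise (\<lambda>\<sigma> \<tau>. finite (fst \<sigma> \<inter> fst \<tau>)) limit_family \<and>
     (\<forall>\<tau>\<in>{(s, x). limit s x}. infinite (fst \<tau>) \<longrightarrow> (\<exists>\<sigma>\<in>limit_family. infinite (fst \<sigma> \<inter> fst \<tau>)))"
    unfolding limit_family_def by (rule someI_ex, rule maximal_almost_disjoint)
  then show "(s, x) \<in> limit_family \<Longrightarrow> limit s x"
    "pairwise (\<lambda>\<sigma> \<tau>. finite (fst \<sigma> \<inter> fst \<tau>)) limit_family" by blast+
  show "\<exists>(t, y)\<in>limit_family. infinite (t \<inter> s)" if "limit s x" "infinite s"
  proof -
    have "\<exists>\<sigma>\<in>limit_family. infinite (fst \<sigma> \<inter> fst (s, x))" 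
      using bspec[OF conjunct2[OF conjunct2[OF *]], of "(s, x)"] that by simp
    then show ?thesis by (auto simp: case_prod_beta)
  qed
qed

lemma limit_infinite:
  assumes "limit s x"
  shows "infinite s"
  using assms unfolding limit_def
proof
  assume "limit_const s x"
  then obtain \<mu> i k where \<mu>: "strict_mono \<mu>" and s: "s = range (\<lambda>n::nat. (\<mu> n, i, k))"
    unfolding limit_const_def by blast
  show "infinite s"
    unfolding s using strict_mono_eq[OF \<mu>] by (intro range_inj_infinite) (simp add: inj_on_def)
next
  assume "limit_incr s x"
  then obtain \<mu> \<iota> k where \<iota>: "strict_mono \<iota>" and s: "s = range (\<lambda>n::nat. (\<mu> n, \<iota> n, k))"
    unfolding limit_incr_def by blast
  show "infinite s"
    unfolding s using strict_mono_eq[OF \<iota>] by (intro range_inj_infinite) (simp add: inj_on_def)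
qed

lemma limit_class: "limit s x \<Longrightarrow> \<exists>k. \<forall>p\<in>s. snd (snd p) = k"
  unfolding limit_def limit_const_def limit_incr_def by fastforce

definition fibre :: "wreal \<Rightarrow> omega1 \<Rightarrow> nat set \<Rightarrow> point set" where
  "fibre l i M = (\<lambda>m. (l, i, m)) ` M"

text \<open>The point \<open>x\<close> is reached with arbitrarily large rank once cofinitely many points of fibres
  of arbitrarily large level are reached. The almost disjoint sets \<open>b x\<close> let all points \<open>x\<close> share
  these fibres. The rank values omit the bit \<open>least_val\<close>, so that a point which has only been
  reached through a fibre does not take part in further limits.\<close>

definition rules :: "(point \<Rightarrow> nat set) \<Rightarrow> (point set \<times> point \<times> cval) set" where
  "rules b = {(s, x, least_val) | s x. (s, x) \<in> limit_family} \<union>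
     {(fibre l i (b x), x, rank_val i) | l i x. True}"

lemma val_neq_top: "least_val \<noteq> top" "rank_val i \<noteq> top" "upto_val i \<noteq> top"
  using neq_top_if_le[OF _ full_val_neq_top] least_val_le(1) rank_val_le(3)
    less_imp_le[OF upto_val_less_full] by blast+

lemma finite_limit_fibre:
  assumes "limit s y"
  shows "finite (s \<inter> fibre l i M)"
proof -
  obtain k where "\<forall>p\<in>s. snd (snd p) = k" using limit_class[OF assms] by blast
  then have "s \<inter> fibre l i M \<subseteq> {(l, i, k)}" by (auto simp: fibre_def)
  then show ?thesis by (rule finite_subset) simp
qed

text \<open>Two limit rules are almost disjoint by the choice of the family, a limit rule and a
  fibre by their classes, and two fibres over the same position by the choice of \<open>b\<close>;
  other fibres are disjoint.\<close>

lemma token_system_rules: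
  assumes b: "\<And>x y. x \<noteq> y \<Longrightarrow> finite (b x \<inter> b y)"
  shows "token_system (rules b) least_val full_val"
proof
  fix \<sigma> \<tau> assume \<sigma>\<tau>: "\<sigma> \<in> rules b" "\<tau> \<in> rules b" "\<sigma> \<noteq> \<tau>"
  have fibres: "finite (fibre l i (b x) \<inter> fibre l' i' (b x'))"
    if "(l, i, x) \<noteq> (l', i', x')" for l i x l' i' x'
  proof (cases "(l, i) = (l', i')")
    case True
    then have "fibre l i (b x) \<inter> fibre l' i' (b x') \<subseteq> fibre l i (b x \<inter> b x')"
      by (auto simp: fibre_def)
    moreover have "finite (fibre l i (b x \<inter> b x'))"
      using True that b[of x x'] by (simp add: fibre_def)
    ultimately show ?thesis by (rule finite_subset)
  next
    case False
    then have "fibre l i (b x) \<inter> fibre l' i' (b x') = {}" by (auto simp: fibre_def)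
    then show ?thesis by simp
  qed
  show "finite (fst \<sigma> \<inter> fst \<tau>)"
    using \<sigma>\<tau> unfolding rules_def
  proof (elim UnE CollectE exE conjE)
    fix s x t y
    assume "\<sigma> = (s, x, least_val)" "(s, x) \<in> limit_family" "\<tau> = (t, y, least_val)" "(t, y) \<in> limit_family"
    then show ?thesis
      using pairwiseD[OF limit_family(2), of "(s, x)" "(t, y)"] \<sigma>\<tau>(3) by auto
  next
    fix s x l i y
    assume "\<sigma> = (s, x, least_val)" "(s, x) \<in> limit_family" "\<tau> = (fibre l i (b y), y, rank_val i)"
    then show ?thesis
      using finite_limit_fibre[OF limit_family(1)] by auto
  next
    fix s x l i y
    assume "\<sigma> = (fibre l i (b y), y, rank_val i)" "\<tau> = (s, x, least_val)" "(s, x) \<in> limit_family"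
    then show ?thesis
      using finite_limit_fibre[OF limit_family(1)] by (auto simp: Int_commute)
  next
    fix l i x l' i' x'
    assume "\<sigma> = (fibre l i (b x), x, rank_val i)" "\<tau> = (fibre l' i' (b x'), x', rank_val i')"
    then show ?thesis
      using fibres[of l i x l' i' x'] \<sigma>\<tau>(3) by auto
  qed
next
  show "v \<noteq> top" if "(s, x, v) \<in> rules b" for s x v
    using that by (auto simp: rules_def val_neq_top val_neq_top[symmetric])
qed (use full_val_neq_top le_full_val val_neq_top in auto)

text \<open>The hull \<open>H\<close> of \<open>C\<close> has levels at most
  \<open>\<alpha>\<close>, so any fibre meeting it grants a rank of at most \<open>\<alpha>\<close>,
  which can be given to all points without making any of them maximal.\<close>

lemma rules_countable:
  assumes "countable C"
  shows "\<exists>\<kappa>. (\<forall>y. \<kappa> y \<noteq> top) \<and> (\<forall>y. full_val \<le> \<kappa> y \<longleftrightarrow> y \<in> C) \<and>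
    (\<forall>s x v. (s, x, v) \<in> rules b \<longrightarrow> infinite {y \<in> s. least_val \<le> \<kappa> y} \<longrightarrow> v \<le> \<kappa> x)"
proof -
  obtain H \<alpha> where H: "C \<subseteq> H" "\<And>p. p \<in> H \<Longrightarrow> level p \<le> \<alpha>"
    "\<And>s x. limit s x \<Longrightarrow> infinite (s \<inter> H) \<Longrightarrow> x \<in> H"
    using countable_limit_hull[OF assms] by metis
  \<comment> \<open>Exactly the points of \<open>H\<close> receive the bit and can trigger rules;
    those outside \<open>C\<close> stay below \<open>full_val\<close> since
    \<open>upto_val \<alpha>\<close> is countable.\<close>
  define \<kappa> where
    "\<kappa> y = (if y \<in> C then full_val else if y \<in> H then upto_val \<alpha> else rank_val \<alpha>)" for y
  have hit: "least_val \<le> \<kappa> y \<longleftrightarrow> y \<in> H" for y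
    using H(1) least_val_le least_val_not_le by (auto simp: \<kappa>_def)
  have rank: "rank_val \<alpha> \<le> \<kappa> y" for y
    using rank_val_le by (auto simp: \<kappa>_def)
  have not_full: "\<not> full_val \<le> upto_val \<alpha>" "\<not> full_val \<le> rank_val \<alpha>"
    using upto_val_less_full[of \<alpha>] rank_val_le(2)[of \<alpha> \<alpha>] by (auto dest: order_trans)
  show ?thesis
  proof (intro exI[of _ \<kappa>] conjI allI impI)
    show "\<kappa> y \<noteq> top" for y using full_val_neq_top val_neq_top by (simp add: \<kappa>_def)
    show "full_val \<le> \<kappa> y \<longleftrightarrow> y \<in> C" for y using not_full by (simp add: \<kappa>_def)
  next
    fix s x v assume rule: "(s, x, v) \<in> rules b" and inf: "infinite {y \<in> s. least_val \<le> \<kappa> y}"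
    have "{y \<in> s. least_val \<le> \<kappa> y} = s \<inter> H" by (auto simp: hit)
    with inf have inf: "infinite (s \<inter> H)" by simp
    from rule show "v \<le> \<kappa> x"
      unfolding rules_def
    proof (elim UnE CollectE exE conjE)
      fix s' x' assume "(s, x, v) = (s', x', least_val)" "(s', x') \<in> limit_family"
      then show ?thesis using H(3)[OF limit_family(1) inf] hit by auto
    next
      fix l i x' assume eq: "(s, x, v) = (fibre l i (b x'), x', rank_val i)"
      obtain p where "p \<in> s" "p \<in> H" using infinite_imp_nonempty[OF inf] by blast
      then have "i \<le> \<alpha>" using H(2)[of p] eq by (auto simp: fibre_def level_def)
      then have "rank_val i \<le> rank_val \<alpha>" by (rule rank_val_le)
      then show ?thesis using eq rank[of x] by (auto intro: order_trans)
    qed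
  qed
qed

text \<open>Closure under the selected limit rules already gives closure under all limits, so
  \<open>H\<close> contains almost all of a fibre at some level above \<open>j\<close>; the infinite
  set \<open>b x\<close> selects from it infinitely many points for \<open>x\<close>.\<close>

lemma rules_uncountable:
  assumes b: "\<And>x. infinite (b x)" and A: "uncountable A" "A \<subseteq> H"
    and closed: "\<And>s x. (s, x, least_val) \<in> rules b \<Longrightarrow> infinite (s \<inter> H) \<Longrightarrow> x \<in> H"
  shows "\<exists>s i. j \<le> i \<and> (s, x, rank_val i) \<in> rules b \<and> infinite (s \<inter> H)"
proof -
  have "limit_closed H"
    unfolding limit_closed_def
  proof (intro allI impI)
    fix s x assume s: "limit s x" "s \<subseteq> H"
    obtain t y where t: "(t, y) \<in> limit_family" "infinite (t \<inter> s)"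
      using limit_family(3)[OF s(1) limit_infinite[OF s(1)]] by blast
    \<comment> \<open>The selected sequence \<open>t\<close> and the arbitrary one \<open>s\<close>
      share an infinite set, which determines both targets.\<close>
    have "y = target (t \<inter> s)" "x = target (t \<inter> s)"
      using limit_target[OF limit_family(1)[OF t(1)] _ t(2)] limit_target[OF s(1) _ t(2)] by auto
    moreover have "y \<in> H"
    proof (rule closed)
      show "(t, y, least_val) \<in> rules b" using t(1) unfolding rules_def by blast
      show "infinite (t \<inter> H)" by (rule infinite_super[OF _ t(2)]) (use s(2) in blast)
    qed
    ultimately show "x \<in> H" by simp
  qed
  then obtain l i k where full: "j \<le> i" "\<And>m. k < m \<Longrightarrow> (l, i, m) \<in> H"
    using uncountable_limit_closure[OF _ A(2,1), of j] by blast
  have "infinite (b x - {..k})" using b by simp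
  then have "infinite (fibre l i (b x - {..k}))"
    unfolding fibre_def by (subst finite_image_iff) (auto simp: inj_on_def)
  moreover have "fibre l i (b x - {..k}) \<subseteq> fibre l i (b x) \<inter> H"
  proof
    fix p assume "p \<in> fibre l i (b x - {..k})"
    then obtain m where "p = (l, i, m)" "m \<in> b x" "\<not> m \<le> k" unfolding fibre_def by blast
    then show "p \<in> fibre l i (b x) \<inter> H" using full(2)[of m] by (simp add: fibre_def)
  qed
  ultimately have "infinite (fibre l i (b x) \<inter> H)" by (rule infinite_super[rotated])
  moreover have "(fibre l i (b x), x, rank_val i) \<in> rules b" unfolding rules_def by blast
  ultimately show ?thesis using full(1) by blast
qed

section \<open>The space of maximal elements\<close>

theorem theorem1p1:
  shows "\<exists>P :: poset_universe gorder. bounded_complete_dcpo P \<and>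
           subtopology (scott_topology P) (Max_elements P)
             homeomorphic_space (cocountable_topology :: real topology)"
proof -
  have "(UNIV :: point set) \<lesssim> (UNIV :: nat set set)"
    using lepoll_trans2[OF point_lepoll_real eqpoll_sym[OF nat_sets_eqpoll_reals]] .
  then obtain g :: "point \<Rightarrow> nat set" where "inj g" unfolding lepoll_def by blast
  then obtain b :: "point \<Rightarrow> nat set"
    where b: "\<And>x. infinite (b x)" "\<And>x y. x \<noteq> y \<Longrightarrow> finite (b x \<inter> b y)"
    by (rule almost_disjoint_nat_sets) blast
  interpret T: token_system "rules b" least_val full_val
    by (rule token_system_rules[OF b(2)])
  obtain f :: "(point \<Rightarrow> cval) \<Rightarrow> poset_universe" where f: "inj f"
    using ex_inj_universe by blast
  obtain e :: "real \<Rightarrow> point" where e: "bij e"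
    using point_eqpoll_real unfolding eqpoll_def by blast
  let ?top = "\<lambda>x :: point. peak x full_val"
  have inj_top: "inj ?top"
  proof (rule injI)
    fix x y assume "?top x = ?top y"
    then have "?top x x = ?top y x" by (rule fun_cong)
    then show "x = y" using full_val_neq_top by (auto simp: peak_def split: if_splits)
  qed
  \<comment> \<open>The topological content, stated for points and the token poset; \<open>e\<close>
    and \<open>f\<close> later only rename points and elements.\<close>
  have scott: "(\<exists>V. scott_open T.token_poset V \<and> V \<inter> Max_elements T.token_poset = ?top ` U) \<longleftrightarrow>
      U = {} \<or> countable (- U)" for U
  proof
    assume "\<exists>V. scott_open T.token_poset V \<and> V \<inter> Max_elements T.token_poset = ?top ` U"
    then obtain V where V: "scott_open T.token_poset V" "V \<inter> range ?top = ?top ` U"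
      by (auto simp: T.Max_elements_token_poset)
    have V_iff: "?top y \<in> V \<longleftrightarrow> y \<in> U" for y
      using V(2) inj_image_mem_iff[OF inj_top, of y U] by blast
    show "U = {} \<or> countable (- U)"
    proof (rule ccontr)
      assume "\<not> ?thesis"
      then obtain x where x: "x \<in> U" and unc: "uncountable (- U)" by blast
      \<comment> \<open>The points whose bit lies in the closed complement of \<open>V\<close>; it
        contains \<open>- U\<close> because \<open>least_val\<close> is below
        \<open>full_val\<close>.\<close>
      let ?H = "{y. peak y least_val \<notin> V}"
      have up: "peak y w \<in> V" if "peak y v \<in> V" "v \<le> w" "w \<noteq> top" for y v w
        by (rule T.scott_open_upD[OF V(1) that(1) _ T.peak_in_elems[OF that(3)]])
          (use that(2) in \<open>simp add: le_fun_def peak_def\<close>)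
      have "- U \<subseteq> ?H"
        using up[OF _ least_val_le(1) full_val_neq_top] V_iff by blast
      moreover have "y \<in> ?H" if "(s, y, least_val) \<in> rules b" "infinite (s \<inter> ?H)" for s y
        using T.scott_open_peak_target[OF V(1) that(1)] that(2) by (auto simp: Int_def)
      ultimately have reach: "\<exists>s i. j \<le> i \<and> (s, x, rank_val i) \<in> rules b \<and> infinite (s \<inter> ?H)" for j
        by (rule rules_uncountable[OF b(1) unc])
      have "peak x (rank_val j) \<notin> V" for j
      proof
        assume j: "peak x (rank_val j) \<in> V"
        obtain s i where i: "j \<le> i" "(s, x, rank_val i) \<in> rules b" "infinite (s \<inter> ?H)"
          using reach by blast
        have "peak x (rank_val i) \<in> V"
          using up[OF j rank_val_le(1)[OF i(1)] val_neq_top(2)] .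
        then show False
          using T.scott_open_peak_target[OF V(1) i(2)] i(3) by (auto simp: Int_def)
      qed
      \<comment> \<open>\<open>V\<close> contains the peak at \<open>x\<close> of the supremum of
        all ranks, hence by openness that of a single rank, contradicting the previous step.\<close>
      moreover have "\<exists>v\<in>range rank_val. peak x v \<in> V"
      proof (rule T.scott_open_peak_Sup[OF V(1)])
        show "\<exists>u\<in>range rank_val. v \<le> u \<and> w \<le> u" if vw: "v \<in> range rank_val" "w \<in> range rank_val" for v w
        proof -
          obtain i j where "v = rank_val i" "w = rank_val j" using vw by blast
          then show ?thesis
            by (intro bexI[of _ "rank_val (max i j)"]) (auto intro: rank_val_le)
        qed
      qed (use x V_iff full_val_neq_top in \<open>auto simp: Sup_rank_val\<close>)
      ultimately show False by blast
    qed
  next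
    assume "U = {} \<or> countable (- U)"
    then show "\<exists>V. scott_open T.token_poset V \<and> V \<inter> Max_elements T.token_poset = ?top ` U"
    proof
      assume "U = {}"
      then show ?thesis by (intro exI[of _ "{}"]) (simp add: scott_open_def)
    next
      assume "countable (- U)"
      then obtain \<kappa> where \<kappa>: "\<forall>y. \<kappa> y \<noteq> top" "\<forall>y. full_val \<le> \<kappa> y \<longleftrightarrow> y \<in> - U"
        "\<forall>s x v. (s, x, v) \<in> rules b \<longrightarrow> infinite {y \<in> s. least_val \<le> \<kappa> y} \<longrightarrow> v \<le> \<kappa> x"
        using rules_countable[of "- U" b] by blast
      let ?V = "{\<phi> \<in> T.elems. \<forall>y. \<not> \<phi> y \<le> \<kappa> y}"
      have "?top x \<in> ?V \<longleftrightarrow> x \<in> U" for x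
      proof -
        have "?top x \<in> T.elems" by (rule T.peak_in_elems[OF full_val_neq_top])
        moreover have "?top x y \<le> \<kappa> y \<longleftrightarrow> y = x \<and> x \<notin> U" for y
          using \<kappa>(1)[rule_format, of y] \<kappa>(2)[rule_format, of x]
          by (simp add: peak_def top.extremum_unique)
        ultimately show ?thesis by blast
      qed
      then have "?V \<inter> Max_elements T.token_poset = ?top ` U"
        unfolding T.Max_elements_token_poset by blast
      moreover have "scott_open T.token_poset ?V"
        by (rule T.scott_open_avoiding) (use \<kappa>(1,3) in blast)+
      ultimately show ?thesis by blast
    qed
  qed
  let ?P = "transport f T.token_poset" and ?h = "\<lambda>r. f (?top (e r))"
  have po: "partial_order T.token_poset" by (rule T.partial_order_token_poset)
  have "subtopology (scott_topology ?P) (Max_elements ?P)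
      homeomorphic_space (cocountable_topology :: real topology)"
  proof (rule homeomorphic_spaceI_scott)
    show "inj ?h"
      using inj_compose[OF f inj_compose[OF inj_top bij_is_inj[OF e]]] by (simp add: comp_def)
    have "range ?h = f ` range (\<lambda>r. ?top (e r))" by (simp only: image_image)
    also have "range (\<lambda>r. ?top (e r)) = ?top ` range e" by (simp only: image_image)
    also have "range e = UNIV" by (rule bij_is_surj[OF e])
    finally show "range ?h = Max_elements ?P"
      unfolding Max_elements_transport[OF f po] T.Max_elements_token_poset .
    show "topspace (cocountable_topology :: real topology) = UNIV" by simp
    fix U :: "real set"
    have "(\<exists>V. scott_open ?P V \<and> V \<inter> Max_elements ?P = ?h ` U) \<longleftrightarrow>
        (\<exists>V. scott_open T.token_poset V \<and> V \<inter> Max_elements T.token_poset = ?top ` e ` U)" (is "?l \<longleftrightarrow> ?r")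
    proof
      assume ?l
      then obtain V where V: "scott_open ?P V" "V \<inter> Max_elements ?P = ?h ` U" by blast
      then have "V \<subseteq> carrier ?P" by (simp add: scott_open_def)
      then obtain W where W: "W \<subseteq> carrier T.token_poset" "V = f ` W"
        using transport_subsetE[OF f po] by blast
      have "f ` (W \<inter> Max_elements T.token_poset) = f ` ?top ` e ` U"
        using V(2) W(2) by (simp add: Max_elements_transport[OF f po] image_Int[OF f] image_image)
      then have "W \<inter> Max_elements T.token_poset = ?top ` e ` U" by (simp only: inj_image_eq_iff[OF f])
      moreover have "scott_open T.token_poset W"
        using V(1) W scott_open_transport[OF f po] by blast
      ultimately show ?r by blast
    next
      assume ?r
      then obtain W where W: "scott_open T.token_poset W" "W \<inter> Max_elements T.token_poset = ?top ` e ` U" by blast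
      then have "W \<subseteq> carrier T.token_poset" by (simp add: scott_open_def)
      then have "scott_open ?P (f ` W)"
        using W(1) scott_open_transport[OF f po] by blast
      moreover have "f ` W \<inter> Max_elements ?P = ?h ` U"
        unfolding Max_elements_transport[OF f po] image_Int[OF f, symmetric] W(2) by (simp add: image_image)
      ultimately show ?l by blast
    qed
    also have "\<dots> \<longleftrightarrow> e ` U = {} \<or> countable (- (e ` U))" by (rule scott)
    also have "- (e ` U) = e ` (- U)" by (rule bij_image_Compl_eq[OF e, symmetric])
    also have "e ` U = {} \<or> countable (e ` (- U)) \<longleftrightarrow> openin cocountable_topology U"
      using countable_image_inj_eq[OF inj_on_subset[OF bij_is_inj[OF e] subset_UNIV]] by simp
    finally show "(\<exists>V. scott_open ?P V \<and> V \<inter> Max_elements ?P = ?h ` U) \<longleftrightarrow>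
        openin cocountable_topology U" .
  qed
  then show ?thesis
    using bounded_complete_dcpo_transport[OF f po T.bounded_complete_dcpo] by blast
qed

end
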